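(* Let $\Phi$ be a field and let $F$ be the free group of finite rank $r>1$. Then there is a (right) module $M$ of maximal growth over $F$, or, equivalently, over the free group algebra $R=\Phi F$, satisfying the following additional properties. (a) $M$ is monomial, that is, induced from a trivial one-dimensional module of a subgroup of $F$. (b) $M$ has a simple submodule $N$ of codimension $1$ (hence the growth of $N$ is also maximal). (c) The modules $M$ and $N$ are periodic in the sense that for any $a\in M$ and $g\in F$ there is a positive integer $m=m(a,g)$ such that $ag^m=a$ (in other words, the orbits of the action of any cyclic subgroup $\langle g\rangle$ of $F$ on $M$ are finite).
   Context: $M$ is induced from the trivial one-dimensional module $L=\Phi$ of a subgroup $K\le F$ if $M\cong L\otimes_{\Phi K}\Phi F$. Fix a free basis $X$ of $F$ with $r$ elements and let $R(n)$ be the span in $R=\Phi F$ of the elements of $F$ of reduced length at most $n$ in $X\cup X^{-1}$. For a right $R$-module $V$ generated by a finite set $A$ the growth function is $g_{A,V}(n)=\dim_\Phi(AR(n))$. Functions $f,g$ are equivalent if for some nonnegative integers $C,C'$ one has $f(n)\le g(n+C)$ and $g(n)\le f(n+C')$ for all $n\ge0$. The growth of a finitely generated module is maximal if its growth function is equivalent to that of the free module of rank 1, i.e. to $(2r-1)^n$ (this does not depend on the finite generating set). An arbitrary module has maximal growth if it contains a finitely generated submodule of maximal growth. *)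

theory Defs
  imports Complex_Main "HOL-Library.Poly_Mapping" "HOL-Computational_Algebra.Group_Closure"
begin

text \<open>
  Groups are rendered by the class \<open>group_add\<close>, which is not assumed to be commutative: the group
  operation is written \<open>+\<close>, the identity \<open>0\<close>, the inverse \<open>- g\<close>. With this convention the
  library's convolution product makes \<open>'g \<Rightarrow>\<^sub>0 'k\<close> the group algebra of \<open>'g\<close> over \<open>'k\<close>.
\<close>

section \<open>Free groups\<close>

text \<open>
  A letter \<open>(x, True)\<close> stands for the generator \<open>x\<close> and \<open>(x, False)\<close> for its inverse. The letters
  are formal: with letters taken from the group itself, the generator of a group of order 2
  would count as a free basis.
\<close>

definition word_val :: "('g::group_add \<times> bool) list \<Rightarrow> 'g" where
  "word_val w = sum_list (map (\<lambda>(x, e). if e then x else - x) w)"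

definition reduced_words :: "'g set \<Rightarrow> ('g \<times> bool) list set" where
  "reduced_words X =
     {w. fst ` set w \<subseteq> X \<and> successively (\<lambda>(x, e) (y, d). \<not> (x = y \<and> e \<noteq> d)) w}"

text \<open>The whole type \<open>'g\<close> is a free group with free basis \<open>X\<close>.\<close>

definition free_basis :: "'g::group_add set \<Rightarrow> bool" where
  "free_basis X \<longleftrightarrow> bij_betw word_val (reduced_words X) UNIV"

definition reduced_length :: "'g::group_add set \<Rightarrow> 'g \<Rightarrow> nat" where
  "reduced_length X g = length (the_inv_into (reduced_words X) word_val g)"

definition is_subgroup :: "'g::group_add set \<Rightarrow> bool" where
  "is_subgroup K \<longleftrightarrow> 0 \<in> K \<and> (\<forall>g\<in>K. \<forall>h\<in>K. g + h \<in> K) \<and> (\<forall>g\<in>K. - g \<in> K)"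

section \<open>Right modules\<close>

locale right_module =
  fixes act :: "'m::ab_group_add \<Rightarrow> 'r::ring_1 \<Rightarrow> 'm"
  assumes act_add_left: "act (x + y) p = act x p + act y p"
    and act_add_right: "act x (p + q) = act x p + act x q"
    and act_mult: "act x (p * q) = act (act x p) q"
    and act_one: "act x 1 = x"

definition submodule :: "('m::ab_group_add \<Rightarrow> 'r::ring_1 \<Rightarrow> 'm) \<Rightarrow> 'm set \<Rightarrow> bool" where
  "submodule act N \<longleftrightarrow>
     0 \<in> N \<and> (\<forall>x\<in>N. \<forall>y\<in>N. x + y \<in> N) \<and> (\<forall>x\<in>N. \<forall>p. act x p \<in> N)"

definition simple_submodule :: "('m::ab_group_add \<Rightarrow> 'r::ring_1 \<Rightarrow> 'm) \<Rightarrow> 'm set \<Rightarrow> bool" where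
  "simple_submodule act N \<longleftrightarrow>
     submodule act N \<and> N \<noteq> {0} \<and> (\<forall>W. submodule act W \<and> W \<subseteq> N \<longrightarrow> W = {0} \<or> W = N)"

section \<open>Modules over the group algebra\<close>

abbreviation grp_elt :: "'g \<Rightarrow> 'g \<Rightarrow>\<^sub>0 'k::field" where
  "grp_elt g \<equiv> Poly_Mapping.single g 1"

text \<open>The scalar \<open>c\<close> is identified with the element \<open>single 0 c\<close> of the group algebra.\<close>

definition scalar ::
  "('m::ab_group_add \<Rightarrow> ('g::group_add \<Rightarrow>\<^sub>0 'k::field) \<Rightarrow> 'm) \<Rightarrow> 'k \<Rightarrow> 'm \<Rightarrow> 'm" where
  "scalar act c x = act x (Poly_Mapping.single 0 c)"

text \<open>
  \<open>N\<close> has codimension \<open>d\<close>: the images of the \<open>d\<close> elements of some \<open>B\<close> form a basis of the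
  quotient of the whole module by \<open>N\<close>.
\<close>

definition has_codim ::
  "('m::ab_group_add \<Rightarrow> ('g::group_add \<Rightarrow>\<^sub>0 'k::field) \<Rightarrow> 'm) \<Rightarrow> 'm set \<Rightarrow> nat \<Rightarrow> bool" where
  "has_codim act N d \<longleftrightarrow>
     (\<exists>B. finite B \<and> card B = d \<and>
        (\<forall>x. \<exists>!c. (\<forall>b. b \<notin> B \<longrightarrow> c b = 0) \<and> x - (\<Sum>b\<in>B. scalar act (c b) b) \<in> N))"

definition periodic ::
  "('m::ab_group_add \<Rightarrow> ('g::group_add \<Rightarrow>\<^sub>0 'k::field) \<Rightarrow> 'm) \<Rightarrow> 'm set \<Rightarrow> bool" where
  "periodic act N \<longleftrightarrow> (\<forall>a\<in>N. \<forall>g. \<exists>m>0. act a (grp_elt g ^ m) = a)"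

section \<open>Growth\<close>

definition ball_span :: "'g::group_add set \<Rightarrow> nat \<Rightarrow> ('g \<Rightarrow>\<^sub>0 'k::field) set" where
  "ball_span X n = module.span (scalar (*)) (grp_elt ` {g. reduced_length X g \<le> n})"

definition growth ::
  "'g::group_add set \<Rightarrow> ('m::ab_group_add \<Rightarrow> ('g \<Rightarrow>\<^sub>0 'k::field) \<Rightarrow> 'm) \<Rightarrow> 'm set \<Rightarrow> nat \<Rightarrow> nat" where
  "growth X act A n =
     vector_space.dim (scalar act)
       (module.span (scalar act) {act a p | a p. a \<in> A \<and> p \<in> ball_span X n})"

definition growth_equiv :: "(nat \<Rightarrow> nat) \<Rightarrow> (nat \<Rightarrow> nat) \<Rightarrow> bool" where
  "growth_equiv f g \<longleftrightarrow> (\<exists>C C'. \<forall>n. f n \<le> g (n + C) \<and> g n \<le> f (n + C'))"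

text \<open>
  The comparison function is the growth function of the group algebra as a right module over
  itself with the generating set \<open>{1}\<close>.
\<close>

definition maximal_growth_fg ::
  "'g::group_add set \<Rightarrow> ('m::ab_group_add \<Rightarrow> ('g \<Rightarrow>\<^sub>0 'k::field) \<Rightarrow> 'm) \<Rightarrow> 'm set \<Rightarrow> bool" where
  "maximal_growth_fg X act V \<longleftrightarrow>
     (\<exists>A. finite A \<and> V = submodule act hull A \<and>
        growth_equiv (growth X act A)
          (growth X ((*) :: ('g \<Rightarrow>\<^sub>0 'k) \<Rightarrow> ('g \<Rightarrow>\<^sub>0 'k) \<Rightarrow> ('g \<Rightarrow>\<^sub>0 'k)) {1}))"

definition maximal_growth ::
  "'g::group_add set \<Rightarrow> ('m::ab_group_add \<Rightarrow> ('g \<Rightarrow>\<^sub>0 'k::field) \<Rightarrow> 'm) \<Rightarrow> 'm set \<Rightarrow> bool" where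
  "maximal_growth X act N \<longleftrightarrow> (\<exists>V\<subseteq>N. submodule act V \<and> maximal_growth_fg X act V)"

section \<open>Induced modules\<close>

text \<open>
  For a subring \<open>S\<close> of \<open>'r\<close> and a right \<open>S\<close>-module \<open>'l\<close>, the tensor product over \<open>S\<close> of \<open>'l\<close> with the
  ring \<open>'r\<close> is the free abelian group on the pairs \<open>(l, b)\<close> modulo the subgroup generated by the
  relators below. Its elements are the classes of the congruence \<open>tensor_cong\<close>; the right
  action of \<open>'r\<close> is the one with \<open>(l \<otimes> b) p = l \<otimes> (b p)\<close>.
\<close>

definition tensor_relators ::
  "('l::ab_group_add \<Rightarrow> 'r::ring_1 \<Rightarrow> 'l) \<Rightarrow> 'r set \<Rightarrow> (('l \<times> 'r) \<Rightarrow>\<^sub>0 int) set" where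
  "tensor_relators actL S =
     {frag_of (l + l', b) - frag_of (l, b) - frag_of (l', b) | l l' b. True} \<union>
     {frag_of (l, b + b') - frag_of (l, b) - frag_of (l, b') | l b b'. True} \<union>
     {frag_of (actL l s, b) - frag_of (l, s * b) | l s b. s \<in> S}"

definition tensor_cong ::
  "('l::ab_group_add \<Rightarrow> 'r::ring_1 \<Rightarrow> 'l) \<Rightarrow> 'r set \<Rightarrow> (('l \<times> 'r) \<Rightarrow>\<^sub>0 int) rel" where
  "tensor_cong actL S = {(z, z'). z - z' \<in> group_closure (tensor_relators actL S)}"

definition tensor_carrier ::
  "('l::ab_group_add \<Rightarrow> 'r::ring_1 \<Rightarrow> 'l) \<Rightarrow> 'r set \<Rightarrow> (('l \<times> 'r) \<Rightarrow>\<^sub>0 int) set set" where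
  "tensor_carrier actL S = UNIV // tensor_cong actL S"

definition tensor_add ::
  "('l::ab_group_add \<Rightarrow> 'r::ring_1 \<Rightarrow> 'l) \<Rightarrow> 'r set \<Rightarrow>
   (('l \<times> 'r) \<Rightarrow>\<^sub>0 int) set \<Rightarrow> (('l \<times> 'r) \<Rightarrow>\<^sub>0 int) set \<Rightarrow> (('l \<times> 'r) \<Rightarrow>\<^sub>0 int) set" where
  "tensor_add actL S Z W = (\<Union>z\<in>Z. \<Union>w\<in>W. tensor_cong actL S `` {z + w})"

definition tensor_act ::
  "('l::ab_group_add \<Rightarrow> 'r::ring_1 \<Rightarrow> 'l) \<Rightarrow> 'r set \<Rightarrow>
   (('l \<times> 'r) \<Rightarrow>\<^sub>0 int) set \<Rightarrow> 'r \<Rightarrow> (('l \<times> 'r) \<Rightarrow>\<^sub>0 int) set" where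
  "tensor_act actL S Z p =
     (\<Union>z\<in>Z. tensor_cong actL S `` {frag_extend (\<lambda>(l, b). frag_of (l, b * p)) z})"

definition iso_tensor ::
  "('m::ab_group_add \<Rightarrow> 'r::ring_1 \<Rightarrow> 'm) \<Rightarrow> ('l::ab_group_add \<Rightarrow> 'r \<Rightarrow> 'l) \<Rightarrow> 'r set \<Rightarrow> bool" where
  "iso_tensor act actL S \<longleftrightarrow>
     (\<exists>f. bij_betw f UNIV (tensor_carrier actL S) \<and>
        (\<forall>x y. f (x + y) = tensor_add actL S (f x) (f y)) \<and>
        (\<forall>x p. f (act x p) = tensor_act actL S (f x) p))"

definition subgroup_algebra :: "'g::group_add set \<Rightarrow> ('g \<Rightarrow>\<^sub>0 'k::field) set" where
  "subgroup_algebra K = {p. Poly_Mapping.keys p \<subseteq> K}"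

text \<open>The one-dimensional module on which every group element acts as the identity.\<close>

definition trivial_act :: "'k::field \<Rightarrow> ('g::group_add \<Rightarrow>\<^sub>0 'k) \<Rightarrow> 'k" where
  "trivial_act l p = l * (\<Sum>g\<in>Poly_Mapping.keys p. Poly_Mapping.lookup p g)"

definition monomial_module ::
  "('m::ab_group_add \<Rightarrow> ('g::group_add \<Rightarrow>\<^sub>0 'k::field) \<Rightarrow> 'm) \<Rightarrow> bool" where
  "monomial_module act \<longleftrightarrow>
     (\<exists>K. is_subgroup K \<and>
        iso_tensor act (trivial_act :: 'k \<Rightarrow> ('g \<Rightarrow>\<^sub>0 'k) \<Rightarrow> 'k) (subgroup_algebra K))"

text \<open>
  In the theorem the existentially quantified module has the underlying abelian group \<open>nat \<Rightarrow>\<^sub>0 'k\<close>.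
  This loses nothing: a monomial module of maximal growth is a quotient of the group algebra of
  a countable group and is infinite-dimensional, so its dimension is countably infinite.
\<close>

end

theory Submission
  imports Defs "HOL-Library.Sublist" "HOL-Library.Countable_Set"
begin

text \<open>
  \<open>M\<close> is the permutation module of a transitive action of \<open>F\<close> on a countable set \<open>V\<close>, and \<open>N\<close>
  consists of its vectors with coefficient sum 0. If finite sets of points admit arbitrary
  transpositions by elements of \<open>F\<close>, then \<open>N\<close> is simple: such an element changes a nonzero vector
  of \<open>N\<close> by a multiple of a difference of two points. If the orbits of all cyclic subgroups
  on \<open>V\<close> are finite, then \<open>M\<close> is periodic. The growth of \<open>N\<close> is governed by the sizes of the
  balls of \<open>V\<close> around a point \<open>o\<close>, because the elements \<open>ox - o\<close> with \<open>x\<close> a letter produce by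
  telescoping exactly the differences \<open>og - o\<close>.

  The action is a limit of modifications of the Cayley tree. A modification cuts two edges
  \<open>v - vx\<close> and \<open>v' - v'x\<^sup>-\<^sup>1\<close>, drops the branches behind them and joins \<open>v\<close> to \<open>v'\<close> by an edge
  labelled \<open>x\<close>. As only finitely many edges have been cut, an infinite orbit of a cyclically
  reduced word runs off along a ray in both directions; cutting both rays far away and joining
  them makes the orbit finite. Likewise a word that carries finitely many points into uncut
  branches can be prolonged so that suitable far away edges realise a given transposition. All
  cuts can be made beyond any given distance, so the steps do not disturb each other and the
  limit loses only a small part of each sphere.
\<close>

section \<open>Words\<close>

type_synonym 'a word = "('a \<times> bool) list"

definition inv_letter :: "'a \<times> bool \<Rightarrow> 'a \<times> bool" where
  "inv_letter l = (fst l, \<not> snd l)"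

definition inv_word :: "'a word \<Rightarrow> 'a word" where
  "inv_word w = rev (map inv_letter w)"

lemma inv_letter_inv_letter [simp]: "inv_letter (inv_letter l) = l"
  by (simp add: inv_letter_def)

lemma inv_letter_neq [simp]: "inv_letter l \<noteq> l" "l \<noteq> inv_letter l"
  by (auto simp: inv_letter_def prod_eq_iff)

lemma inv_letter_eq_iff [simp]: "inv_letter k = inv_letter l \<longleftrightarrow> k = l"
  by (auto simp: inv_letter_def prod_eq_iff)

lemma fst_inv_letter [simp]: "fst (inv_letter l) = fst l"
  by (simp add: inv_letter_def)

lemma inv_letter_mem [simp]: "inv_letter l \<in> X \<times> UNIV \<longleftrightarrow> l \<in> X \<times> UNIV"
  by (auto simp: inv_letter_def mem_Times_iff)

lemma inv_word_simps [simp]: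
  "inv_word [] = []"
  "inv_word (l # w) = inv_word w @ [inv_letter l]"
  "inv_word (v @ w) = inv_word w @ inv_word v"
  "inv_word (inv_word w) = w"
  "length (inv_word w) = length w"
  "inv_word w = [] \<longleftrightarrow> w = []"
  by (simp_all add: inv_word_def rev_map o_def)

lemma set_inv_word: "set (inv_word w) = inv_letter ` set w"
  by (simp add: inv_word_def)

lemma inv_word_mem [simp]: "set (inv_word w) \<subseteq> X \<times> UNIV \<longleftrightarrow> set w \<subseteq> X \<times> UNIV"
  unfolding set_inv_word image_subset_iff subset_eq ball_simps by (simp only: inv_letter_mem)

lemma nth_inv_word: "i < length w \<Longrightarrow> inv_word w ! i = inv_letter (w ! (length w - Suc i))"
  by (simp add: inv_word_def rev_nth)

abbreviation reduced :: "'a word \<Rightarrow> bool" where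
  "reduced \<equiv> successively (\<lambda>k l. l \<noteq> inv_letter k)"

lemma reduced_words_eq:
  fixes X :: "'a set"
  shows "reduced_words X = {w. set w \<subseteq> X \<times> UNIV \<and> reduced w}"
proof -
  have "(\<lambda>(x, e) (y, d). \<not> (x = y \<and> e \<noteq> d)) = (\<lambda>k (l :: 'a \<times> bool). l \<noteq> inv_letter k)"
    by (auto simp: fun_eq_iff inv_letter_def)
  moreover have "fst ` set w \<subseteq> X \<longleftrightarrow> set w \<subseteq> X \<times> UNIV" for w :: "'a word"
    by force
  ultimately show ?thesis
    by (simp only: reduced_words_def)
qed

lemma reduced_inv_word: "reduced w \<Longrightarrow> reduced (inv_word w)"
  unfolding inv_word_def successively_rev successively_map
  by (erule successively_mono) (metis inv_letter_inv_letter)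

lemma reduced_snoc: "reduced (w @ [l]) \<longleftrightarrow> reduced w \<and> (w = [] \<or> last w \<noteq> inv_letter l)"
  by (auto simp: successively_append_iff)

lemma reduced_words_prefix: "w \<in> reduced_words X \<Longrightarrow> prefix v w \<Longrightarrow> v \<in> reduced_words X"
  by (auto simp: reduced_words_eq prefix_def successively_append_iff)

lemma finite_reduced_words_length:
  assumes "finite X" shows "finite {w \<in> reduced_words X. length w = n}"
proof (rule finite_subset)
  show "{w \<in> reduced_words X. length w = n} \<subseteq> {w. set w \<subseteq> X \<times> UNIV \<and> length w = n}"
    by (auto simp: reduced_words_eq)
  show "finite {w. set w \<subseteq> X \<times> (UNIV :: bool set) \<and> length w = n}"
    using assms by (intro finite_lists_length_eq) auto
qed

section \<open>Gluings of the Cayley tree\<close>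

text \<open>A glued word \<open>v @ [l]\<close> with partner \<open>v' @ [inv_letter l]\<close> stands for an edge labelled \<open>l\<close>
  from \<open>v\<close> to \<open>v'\<close>.\<close>

definition step :: "('a word \<Rightarrow> 'a word option) \<Rightarrow> 'a word \<Rightarrow> 'a \<times> bool \<Rightarrow> 'a word" where
  "step \<mu> v l =
     (if v \<noteq> [] \<and> last v = inv_letter l then butlast v
      else case \<mu> (v @ [l]) of None \<Rightarrow> v @ [l] | Some w \<Rightarrow> butlast w)"

abbreviation run :: "('a word \<Rightarrow> 'a word option) \<Rightarrow> 'a word \<Rightarrow> 'a word \<Rightarrow> 'a word" where
  "run \<mu> \<equiv> foldl (step \<mu>)"

text \<open>The prefixes exclude every glued word together with the whole branch behind it; what
  remains is the vertex set of the modified graph.\<close>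

definition verts :: "'a set \<Rightarrow> ('a word \<Rightarrow> 'a word option) \<Rightarrow> 'a word set" where
  "verts X \<mu> = {v \<in> reduced_words X. \<forall>p. prefix p v \<longrightarrow> \<mu> p = None}"

text \<open>The basic neighbourhoods of the category argument in \<open>generic_gluing\<close>:
  gluings are close if they coincide on all short words.\<close>

definition agree :: "nat \<Rightarrow> ('a word \<Rightarrow> 'b) \<Rightarrow> ('a word \<Rightarrow> 'b) \<Rightarrow> bool" where
  "agree d \<mu> \<mu>' \<longleftrightarrow> (\<forall>w. length w \<le> d \<longrightarrow> \<mu>' w = \<mu> w)"

lemma agree_mono: "agree d \<mu> \<mu>' \<Longrightarrow> d' \<le> d \<Longrightarrow> agree d' \<mu> \<mu>'"
  by (auto simp: agree_def)

lemma verts_prefix: "v \<in> verts X \<mu> \<Longrightarrow> prefix u v \<Longrightarrow> u \<in> verts X \<mu>"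
  unfolding verts_def by (blast intro: reduced_words_prefix prefix_order.trans)

lemma verts_appendD: "u @ v \<in> verts X \<mu> \<Longrightarrow> u \<in> verts X \<mu>"
  using verts_prefix[of "u @ v" X \<mu> u] by simp

lemma verts_snoc:
  "v @ [l] \<in> verts X \<mu> \<longleftrightarrow>
     v \<in> verts X \<mu> \<and> l \<in> X \<times> UNIV \<and> (v = [] \<or> last v \<noteq> inv_letter l) \<and> \<mu> (v @ [l]) = None"
  by (auto simp: verts_def reduced_words_eq reduced_snoc)

lemma verts_append_long:
  assumes "v \<in> verts X \<mu>" "v @ w \<in> reduced_words X"
    and "\<And>w'. \<mu> w' \<noteq> None \<Longrightarrow> length w' \<le> length v"
  shows "v @ w \<in> verts X \<mu>"
  unfolding verts_def
proof (safe intro!: assms(2))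
  fix p assume "prefix p (v @ w)"
  show "\<mu> p = None"
  proof (rule ccontr)
    assume "\<mu> p \<noteq> None"
    then have "prefix p v"
      using \<open>prefix p (v @ w)\<close> assms(3) by (meson prefix_length_prefix prefixI)
    then show False
      using assms(1) \<open>\<mu> p \<noteq> None\<close> by (auto simp: verts_def)
  qed
qed

lemma agree_verts:
  assumes "agree d \<mu> \<mu>'" "length v \<le> d"
  shows "v \<in> verts X \<mu>' \<longleftrightarrow> v \<in> verts X \<mu>"
proof -
  have "\<mu>' p = \<mu> p" if "prefix p v" for p
    using assms prefix_length_le[OF that] by (simp add: agree_def)
  then show ?thesis
    by (auto simp: verts_def)
qed

text \<open>On the way from a prefix to the vertex no letter cancels and no cut is met.\<close>

lemma run_push:
  assumes "v @ w \<in> verts X \<mu>" shows "run \<mu> v w = v @ w"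
  using assms
proof (induction w rule: rev_induct)
  case (snoc l w)
  then have "v @ w \<in> verts X \<mu>"
    by (metis append_assoc verts_appendD)
  then show ?case
    using snoc verts_snoc[of "v @ w" l X \<mu>] by (auto simp: step_def)
qed simp

text \<open>A fixed run consults the gluing at finitely many words only. This makes conditions on
  runs open.\<close>

lemma run_agree: "\<exists>d. \<forall>\<mu>'. agree d \<mu> \<mu>' \<longrightarrow> run \<mu>' v w = run \<mu> v w"
proof (induction w rule: rev_induct)
  case (snoc l w)
  then obtain d where d: "\<And>\<mu>'. agree d \<mu> \<mu>' \<Longrightarrow> run \<mu>' v w = run \<mu> v w"
    by auto
  \<comment> \<open>The last step consults the gluing at the word reached so far with
    \<open>l\<close> appended, whence the \<open>Suc\<close>.\<close>
  let ?d = "max d (Suc (length (run \<mu> v w)))"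
  have "run \<mu>' v (w @ [l]) = run \<mu> v (w @ [l])" if "agree ?d \<mu> \<mu>'" for \<mu>'
  proof -
    have "\<mu>' (run \<mu> v w @ [l]) = \<mu> (run \<mu> v w @ [l])"
      using that by (auto simp: agree_def)
    moreover have "run \<mu>' v w = run \<mu> v w"
      using d[of \<mu>'] that agree_mono[of ?d \<mu> \<mu>' d] by simp
    ultimately show ?thesis
      unfolding foldl_append foldl.simps step_def by presburger
  qed
  then show ?case
    by blast
qed simp

lemma run_agree_finite:
  assumes "finite P"
  shows "\<exists>d. \<forall>\<mu>'. agree d \<mu> \<mu>' \<longrightarrow> (\<forall>(v, w) \<in> P. run \<mu>' v w = run \<mu> v w)"
  using assms
proof (induction P)
  case (insert x P)
  obtain d where d: "\<And>\<mu>'. agree d \<mu> \<mu>' \<Longrightarrow> \<forall>(v, w) \<in> P. run \<mu>' v w = run \<mu> v w"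
    using insert.IH by blast
  obtain d' where d': "\<And>\<mu>'. agree d' \<mu> \<mu>' \<Longrightarrow> run \<mu>' (fst x) (snd x) = run \<mu> (fst x) (snd x)"
    using run_agree by metis
  have "\<forall>(v, w) \<in> insert x P. run \<mu>' v w = run \<mu> v w" if "agree (max d d') \<mu> \<mu>'" for \<mu>'
    using d[of \<mu>'] d'[of \<mu>'] that agree_mono[of "max d d'" \<mu> \<mu>'] by (auto simp: case_prod_unfold)
  then show ?case
    by blast
qed simp

text \<open>
  The bound \<open>glued_sparse\<close> is weak enough to survive adding any number of sufficiently long words
  and strong enough to keep more than \<open>(2 * card X - 1) ^ n\<close> vertices in every level \<open>n > 0\<close>.
\<close>

locale gluing =
  fixes X :: "'a set" and \<mu> :: "'a word \<Rightarrow> 'a word option"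
  assumes glued_reduced: "\<mu> w = Some w' \<Longrightarrow> w \<in> reduced_words X"
    and glued_nonempty: "\<mu> [] = None"
    and glued_sym: "\<mu> w = Some w' \<Longrightarrow> \<mu> w' = Some w"
    and glued_last: "\<mu> w = Some w' \<Longrightarrow> last w' = inv_letter (last w)"
    and glued_prefix: "\<mu> w \<noteq> None \<Longrightarrow> \<mu> w' \<noteq> None \<Longrightarrow> prefix w w' \<Longrightarrow> w = w'"
    and glued_butlast: "\<mu> w \<noteq> None \<Longrightarrow> \<mu> w' \<noteq> None \<Longrightarrow> butlast w = butlast w' \<Longrightarrow> w = w'"
    and glued_sparse: "card {w \<in> dom \<mu>. length w = Suc n} \<le> n"
begin

lemma Nil_verts: "[] \<in> verts X \<mu>"
  by (auto simp: verts_def reduced_words_eq glued_nonempty)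

text \<open>The antichain condition \<open>glued_prefix\<close> prevents one cut from removing the
  end of an edge attached at another.\<close>

lemma butlast_glued_verts:
  assumes "\<mu> w = Some w'" shows "butlast w \<in> verts X \<mu>"
proof -
  have "w \<noteq> []"
    using assms glued_nonempty by auto
  have "\<mu> p = None" if "prefix p (butlast w)" for p
  proof (rule ccontr)
    assume "\<mu> p \<noteq> None"
    then have "p = w"
      using glued_prefix[of p w] assms prefix_order.trans[OF that prefixeq_butlast] by simp
    then show False
      using prefix_length_le[OF that] \<open>w \<noteq> []\<close> unfolding length_butlast
      by (metis diff_less length_greater_0_conv not_less zero_less_one)
  qed
  then show ?thesis
    using reduced_words_prefix[OF glued_reduced[OF assms] prefixeq_butlast] by (simp add: verts_def)
qed

lemma step_verts:
  assumes "v \<in> verts X \<mu>" "l \<in> X \<times> UNIV" shows "step \<mu> v l \<in> verts X \<mu>"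
proof (cases "v \<noteq> [] \<and> last v = inv_letter l")
  case True
  then show ?thesis
    using verts_prefix[OF assms(1) prefixeq_butlast] by (simp add: step_def)
next
  case False
  show ?thesis
  proof (cases "\<mu> (v @ [l])")
    case None
    then show ?thesis
      using False assms by (auto simp: step_def verts_snoc)
  next
    case (Some w)
    then show ?thesis
      using False butlast_glued_verts[OF glued_sym[OF Some]] by (auto simp: step_def)
  qed
qed

lemma run_verts: "v \<in> verts X \<mu> \<Longrightarrow> set w \<subseteq> X \<times> UNIV \<Longrightarrow> run \<mu> v w \<in> verts X \<mu>"
  by (induction w arbitrary: v) (simp_all add: step_verts)

text \<open>The case beyond pushing and cancelling is a glued edge. The partner word is reduced, so
  its vertex does not end in \<open>l\<close>; the return step therefore does not backtrack, and by
  the symmetry of \<open>\<mu>\<close> it crosses the same edge.\<close>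

lemma step_inv_letter:
  assumes "v \<in> verts X \<mu>" shows "step \<mu> (step \<mu> v l) (inv_letter l) = v"
proof (cases "v \<noteq> [] \<and> last v = inv_letter l")
  case True
  then obtain u where v: "v = u @ [inv_letter l]"
    by (metis append_butlast_last_id)
  then have "u = [] \<or> last u \<noteq> l" "\<mu> (u @ [inv_letter l]) = None"
    using assms by (auto simp: verts_snoc)
  then show ?thesis
    unfolding v by (auto simp: step_def)
next
  case False
  show ?thesis
  proof (cases "\<mu> (v @ [l])")
    case None
    then show ?thesis
      using False by (auto simp: step_def)
  next
    case (Some w)
    then have "w \<noteq> []"
      using glued_sym[OF Some] glued_nonempty by (cases w) simp_all
    moreover have "last w = inv_letter l"
      using glued_last[OF Some] by simp
    ultimately obtain u where w: "w = u @ [inv_letter l]"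
      by (metis append_butlast_last_id)
    have "\<mu> (u @ [inv_letter l]) = Some (v @ [l])"
      using glued_sym[OF Some] unfolding w .
    moreover have "reduced (u @ [inv_letter l])"
      using glued_reduced[OF calculation] by (simp add: reduced_words_eq)
    then have "u = [] \<or> last u \<noteq> l"
      by (auto simp: reduced_snoc)
    moreover have "step \<mu> v l = u"
      using False Some w by (auto simp: step_def)
    ultimately show ?thesis
      by (auto simp: step_def)
  qed
qed

lemma run_inv_word:
  assumes "v \<in> verts X \<mu>" "set w \<subseteq> X \<times> UNIV"
  shows "run \<mu> (run \<mu> v w) (inv_word w) = v"
  using assms
proof (induction w arbitrary: v)
  case (Cons l w)
  then show ?case
    using step_verts[of v l] step_inv_letter[of v l] by simp
qed simp

lemma run_inj:
  assumes "v \<in> verts X \<mu>" "v' \<in> verts X \<mu>" "set w \<subseteq> X \<times> UNIV" "run \<mu> v w = run \<mu> v' w"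
  shows "v = v'"
  by (metis assms run_inv_word)

end

section \<open>Finite extensions of a gluing beyond a given level\<close>

definition extends :: "'a set \<Rightarrow> nat \<Rightarrow> ('a word \<Rightarrow> 'a word option) \<Rightarrow> ('a word \<Rightarrow> 'a word option) \<Rightarrow> bool" where
  "extends X d \<mu> \<mu>' \<longleftrightarrow> gluing X \<mu>' \<and> finite (dom \<mu>') \<and> agree d \<mu> \<mu>'"

text \<open>Old glued words have length at most \<open>d\<close> and new ones are longer, so the two
  kinds can only conflict by an old word being a prefix of a new one. This is excluded because new
  words are vertices of the old graph.\<close>

lemma gluing_extend:
  assumes "gluing X \<mu>" "finite (dom \<mu>)" "finite C" "C \<subseteq> verts X \<mu>"
    and f: "\<And>w. w \<in> C \<Longrightarrow> f w \<in> C" "\<And>w. w \<in> C \<Longrightarrow> f (f w) = w"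
      "\<And>w. w \<in> C \<Longrightarrow> last (f w) = inv_letter (last w)"
    and antichain: "\<And>w w'. w \<in> C \<Longrightarrow> w' \<in> C \<Longrightarrow> prefix w w' \<Longrightarrow> w = w'"
    and inj: "inj_on butlast C"
    and long: "\<And>w. w \<in> C \<Longrightarrow> d < length w"
    and short: "\<And>w. w \<in> dom \<mu> \<Longrightarrow> length w \<le> d"
    and card: "card (dom \<mu>) + card C \<le> d"
  shows "extends X d \<mu> (\<lambda>w. if w \<in> C then Some (f w) else \<mu> w)"
proof -
  interpret gluing X \<mu> by fact
  define \<mu>' where "\<mu>' = (\<lambda>w. if w \<in> C then Some (f w) else \<mu> w)"
  have new: "\<mu> w = None" if "w \<in> C" for w
    using long[OF that] short[of w] by (cases "\<mu> w") auto
  have dom: "dom \<mu>' = dom \<mu> \<union> C"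
    using new by (auto simp: \<mu>'_def split: if_splits)
  have mem: "w \<in> C \<or> w \<notin> C \<and> w \<in> dom \<mu> \<and> length w \<le> d" if "\<mu>' w \<noteq> None" for w
    using that short[of w] by (auto simp: \<mu>'_def split: if_splits)
  have "gluing X \<mu>'"
  proof
    fix w w' assume w: "\<mu>' w = Some w'"
    show "w \<in> reduced_words X"
      using w glued_reduced assms(4) by (auto simp: \<mu>'_def verts_def split: if_splits)
    show "\<mu>' w' = Some w"
      using w f glued_sym[of w w'] new[of w'] by (auto simp: \<mu>'_def split: if_splits)
    show "last w' = inv_letter (last w)"
      using w f glued_last[of w w'] by (auto simp: \<mu>'_def split: if_splits)
  next
    show "\<mu>' [] = None"
      using long[of "[]"] glued_nonempty by (auto simp: \<mu>'_def)
  next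
    fix w w' assume w: "\<mu>' w \<noteq> None" "\<mu>' w' \<noteq> None" "prefix w w'"
    consider "w \<in> C" "w' \<in> C" | "w \<in> dom \<mu>" "w' \<in> dom \<mu>" | "w \<in> C" "length w' \<le> d"
      | "w \<in> dom \<mu>" "w' \<in> C"
      using mem[OF w(1)] mem[OF w(2)] by blast
    then show "w = w'"
    proof cases
      case 1
      then show ?thesis
        using w(3) by (rule antichain)
    next
      case 2
      then show ?thesis
        using w(3) glued_prefix[of w w'] by auto
    next
      case 3
      then show ?thesis
        using long[of w] prefix_length_le[OF w(3)] by linarith
    next
      case 4
      then show ?thesis
        using w(3) assms(4) by (auto simp: verts_def)
    qed
  next
    fix w w' assume w: "\<mu>' w \<noteq> None" "\<mu>' w' \<noteq> None" "butlast w = butlast w'"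
    have ne: "w \<noteq> []" "w' \<noteq> []"
      using w long[of "[]"] glued_nonempty by (auto simp: \<mu>'_def split: if_splits)
    have "length w = length w'"
    proof -
      have "length w - 1 = length w' - 1"
        using arg_cong[OF w(3), of length] unfolding length_butlast .
      moreover have "length w > 0" "length w' > 0"
        using ne by simp_all
      ultimately show ?thesis
        by linarith
    qed
    consider "w \<in> C" "w' \<in> C" | "w \<in> dom \<mu>" "w' \<in> dom \<mu>" | "w \<in> C" "length w' \<le> d"
      | "length w \<le> d" "w' \<in> C"
      using mem[OF w(1)] mem[OF w(2)] by blast
    then show "w = w'"
    proof cases
      case 1
      then show ?thesis
        using w(3) inj by (auto dest: inj_onD)
    next
      case 2
      then show ?thesis
        using w(3) glued_butlast[of w w'] by auto
    next
      case 3
      then show ?thesis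
        using long[of w] \<open>length w = length w'\<close> by linarith
    next
      case 4
      then show ?thesis
        using long[of w'] \<open>length w = length w'\<close> by linarith
    qed
  next
    fix n
    show "card {w \<in> dom \<mu>'. length w = Suc n} \<le> n"
    \<comment> \<open>Levels up to \<open>d\<close> are unchanged. If \<open>Suc n > d\<close>, then
      all glued words together number at most \<open>d \<le> n\<close>, so a crude count
      suffices.\<close>
    proof (cases "Suc n \<le> d")
      case True
      then have "{w \<in> dom \<mu>'. length w = Suc n} = {w \<in> dom \<mu>. length w = Suc n}"
        using long unfolding dom by fastforce
      then show ?thesis
        using glued_sparse by simp
    next
      case False
      have "card {w \<in> dom \<mu>'. length w = Suc n} \<le> card (dom \<mu> \<union> C)"
        using assms(2,3) by (intro card_mono) (auto simp: dom)
      also have "\<dots> \<le> d"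
        using card card_Un_le[of "dom \<mu>" C] by linarith
      finally show ?thesis
        using False by linarith
    qed
  qed
  moreover have "finite (dom \<mu>')"
    using assms(2,3) by (simp add: dom)
  moreover have "agree d \<mu> \<mu>'"
    using long by (auto simp: agree_def \<mu>'_def dest: leD)
  ultimately show ?thesis
    by (simp add: extends_def \<mu>'_def)
qed

section \<open>Cyclically reduced words and their infinite powers\<close>

definition cyclically_reduced :: "'a word \<Rightarrow> bool" where
  "cyclically_reduced c \<longleftrightarrow> c \<noteq> [] \<and> reduced c \<and> hd c \<noteq> inv_letter (last c)"

text \<open>The infinite power of \<open>c\<close>, letter by letter; an orbit can thus be stopped
  in the middle of a copy of \<open>c\<close>.\<close>

definition cyc :: "'a word \<Rightarrow> nat \<Rightarrow> 'a \<times> bool" where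
  "cyc c i = c ! (i mod length c)"

lemma cyc_mem: "c \<noteq> [] \<Longrightarrow> set c \<subseteq> S \<Longrightarrow> cyc c i \<in> S"
  using nth_mem[of "i mod length c" c] by (auto simp: cyc_def)

text \<open>Inside a copy of \<open>c\<close> this is reducedness; at the seam of two copies it is
  the condition on the first and last letters.\<close>

lemma cyc_reduced:
  assumes "cyclically_reduced c" shows "cyc c (Suc i) \<noteq> inv_letter (cyc c i)"
proof (cases "Suc (i mod length c) = length c")
  case True
  then have "i mod length c = length c - 1" "Suc i mod length c = 0"
    by (simp_all add: mod_Suc)
  then have "cyc c i = last c" "cyc c (Suc i) = hd c"
    using assms by (simp_all add: cyc_def cyclically_reduced_def last_conv_nth hd_conv_nth)
  then show ?thesis
    using assms by (auto simp: cyclically_reduced_def)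
next
  case False
  then show ?thesis
    using assms mod_less_divisor[of "length c" i]
    by (auto simp: cyc_def mod_Suc cyclically_reduced_def successively_conv_nth Suc_lessI)
qed

lemma map_cyc: "map (cyc c) [0..<m * length c] = concat (replicate m c)"
proof (induction m)
  case (Suc m)
  have "map (cyc c) [m * length c..<m * length c + length c] = c"
    by (rule nth_equalityI) (auto simp: cyc_def)
  then have "map (cyc c) [0..<m * length c + length c] = concat (replicate m c) @ c"
    using Suc by (subst upt_add_eq_append) auto
  then show ?case
    by (simp add: add.commute flip: replicate_append_same)
qed simp

lemma cyclically_reduced_inv_word:
  assumes "cyclically_reduced c" shows "cyclically_reduced (inv_word c)"
proof -
  have "hd (inv_word c) = inv_letter (last c)" "last (inv_word c) = inv_letter (hd c)"
    using assms by (simp_all add: cyclically_reduced_def inv_word_def hd_rev last_rev last_map hd_map)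
  then show ?thesis
    using assms reduced_inv_word[of c] unfolding cyclically_reduced_def by auto
qed

text \<open>Reading the inverse of \<open>c\<close> forwards means reading \<open>N\<close> copies
  of \<open>c\<close> backwards with inverted letters. The freedom in \<open>N\<close> allows the
  backward orbit to be indexed against the forward one with any total length that is a sufficiently
  large multiple of \<open>length c\<close>.\<close>

lemma cyc_inv_word:
  assumes "c \<noteq> []" "i < N * length c"
  shows "cyc (inv_word c) i = inv_letter (cyc c (N * length c - Suc i))"
proof -
  define n where "n = length c"
  have "n > 0"
    using assms by (simp add: n_def)
  define q r where "q = i div n" and "r = i mod n"
  have i: "i = q * n + r" and "r < n"
    using \<open>n > 0\<close> by (simp_all add: q_def r_def)
  have "q < N"
    using assms(2) by (simp add: q_def n_def less_mult_imp_div_less)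
  then obtain t where t: "N = Suc (q + t)"
    using less_imp_Suc_add by blast
  have "N * n - Suc i = t * n + (n - Suc r)"
    using \<open>r < n\<close> by (simp add: i t algebra_simps)
  then have "(N * n - Suc i) mod n = n - Suc r"
    using \<open>n > 0\<close> by simp
  then show ?thesis
    using \<open>r < n\<close> by (simp add: cyc_def nth_inv_word flip: n_def r_def)
qed

section \<open>Rays and bounded orbits\<close>

context gluing
begin

text \<open>The first step that leaves level \<open>B\<close> pushes a letter. From then on nothing
  can happen but pushing: \<open>F\<close> never cancels its own last letter, and no glued words are
  left at these levels.\<close>

lemma ray_escape:
  assumes short: "\<And>w. w \<in> dom \<mu> \<Longrightarrow> length w \<le> B" and "length v \<le> B"
    and F: "\<And>i. F (Suc i) \<noteq> inv_letter (F i)"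
    and ex: "\<exists>i. B < length (run \<mu> v (map F [0..<i]))"
  shows "\<exists>a p. length p = B \<and> (\<forall>k. run \<mu> v (map F [0..<a + k]) = p @ map F [a..<a + k])"
proof -
  define V where "V i = run \<mu> v (map F [0..<i])" for i
  have V: "V (Suc i) = step \<mu> (V i) (F i)" for i
    by (simp add: V_def)
  define i where "i = (LEAST i. B < length (V i))"
  have i: "B < length (V i)" "\<And>j. j < i \<Longrightarrow> length (V j) \<le> B"
    using ex LeastI_ex[of "\<lambda>i. B < length (V i)"] not_less_Least[of _ "\<lambda>i. B < length (V i)"]
    by (auto simp: V_def i_def not_less)
  have "i \<noteq> 0"
    using i(1) assms(2) by (auto simp: V_def intro: ccontr)
  then obtain a where a: "i = Suc a"
    using not0_implies_Suc by auto
  \<comment> \<open>Crossing a glued edge ends within level \<open>B\<close>, so the escaping step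
    is a push, and it starts at level exactly \<open>B\<close>.\<close>
  have "length (butlast w) \<le> B" if "\<mu> u = Some w" for u w
    using short[of w] glued_sym[OF that] by (auto simp: dom_def)
  then have push: "V (Suc a) = V a @ [F a]" "length (V a) = B"
    using i(1) i(2)[of a] unfolding a V
    by (auto simp: step_def split: if_splits option.splits) (metis not_le)+
  have "V (a + k) = V a @ map F [a..<a + k]" for k
  proof (induction k)
    case (Suc k)
    show ?case
    proof (cases k)
      case 0
      then show ?thesis
        using push by simp
    next
      case (Suc k')
      have "\<mu> (V a @ map F [a..<Suc (a + k)]) = None"
        using short[of "V a @ map F [a..<Suc (a + k)]"] push(2) by fastforce
      moreover have "last (V a @ map F [a..<a + k]) \<noteq> inv_letter (F (a + k))"
        using F[of "a + k'"] Suc by (auto simp: last_map)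
      ultimately show ?thesis
        using Suc.IH by (simp add: V step_def)
    qed
  qed simp
  then show ?thesis
    using push(2) unfolding V_def by blast
qed

text \<open>By the pigeonhole principle two powers of \<open>c\<close> lead to the same vertex,
  there being finitely many vertices up to level \<open>B\<close>. Runs are injective, so the common
  part of the two powers can be cancelled.\<close>

lemma bounded_orbit_periodic:
  assumes "finite X" "v \<in> verts X \<mu>" "c \<noteq> []" "set c \<subseteq> X \<times> UNIV"
    and bounded: "\<And>i. length (run \<mu> v (map (cyc c) [0..<i])) \<le> B"
  shows "\<exists>m>0. run \<mu> v (concat (replicate m c)) = v"
proof -
  define V where "V m = run \<mu> v (concat (replicate m c))" for m
  have set: "set (concat (replicate m c)) \<subseteq> X \<times> UNIV" for m
    using assms(4) by (auto split: if_splits)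
  have "range V \<subseteq> (\<Union>n\<le>B. {w \<in> reduced_words X. length w = n})"
    using run_verts[OF assms(2) set] bounded[of "_ * length c"]
    by (auto simp: V_def map_cyc verts_def)
  then have "finite (range V)"
    by (rule finite_subset) (simp add: finite_reduced_words_length[OF assms(1)])
  then have "\<not> inj V"
    using finite_imageD by blast
  then obtain i j where "i < j" "V i = V j"
    by (metis injI linorder_neqE_nat)
  define m where "m = j - i"
  have "concat (replicate j c) = concat (replicate m c) @ concat (replicate i c)"
    using \<open>i < j\<close> by (simp add: m_def flip: concat_append replicate_add)
  then have "run \<mu> (V m) (concat (replicate i c)) = run \<mu> v (concat (replicate i c))"
    using \<open>V i = V j\<close> by (simp add: V_def)
  then have "V m = v"
    using run_inj[OF _ assms(2) set] run_verts[OF assms(2) set, of m] by (auto simp: V_def)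
  moreover have "m > 0"
    using \<open>i < j\<close> by (simp add: m_def)
  ultimately show ?thesis
    by (auto simp: V_def)
qed

end

section \<open>Closing an infinite orbit\<close>

lemma extends_mono: "extends X d \<mu> \<mu>' \<Longrightarrow> d' \<le> d \<Longrightarrow> extends X d' \<mu> \<mu>'"
  by (auto simp: extends_def intro: agree_mono)

lemma extends_refl: "gluing X \<mu> \<Longrightarrow> finite (dom \<mu>) \<Longrightarrow> extends X d \<mu> \<mu>"
  by (simp add: extends_def agree_def)

lemma inv_word_power: "inv_word (concat (replicate m c)) = concat (replicate m (inv_word c))"
proof (induction m)
  case (Suc m)
  have "concat (replicate (Suc m) (inv_word c)) = concat (replicate m (inv_word c)) @ inv_word c"
    unfolding replicate_Suc replicate_append_same[symmetric] by simp
  then show ?case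
    using Suc by simp
qed simp

lemma prefix_nth: "prefix v w \<Longrightarrow> i < length v \<Longrightarrow> w ! i = v ! i"
  by (auto simp: prefix_def nth_append)

lemma step_glued:
  assumes "v @ [l] \<in> verts X \<mu>" "\<mu>' (v @ [l]) = Some w"
  shows "step \<mu>' v l = butlast w"
  using assms by (auto simp: step_def verts_snoc)

text \<open>Density of the periodicity condition. The forward ray spells \<open>F\<close>, the
  backward ray spells \<open>G\<close>. Both are cut at places where the letters of \<open>c\<close>
  match, so that the path out, over the new edge and back to \<open>v\<close> spells a whole number
  of copies of \<open>c\<close>.\<close>

proposition close_orbit:
  assumes "gluing X \<mu>" "finite (dom \<mu>)" "finite X" and v: "v \<in> verts X \<mu>"
    and c: "cyclically_reduced c" "set c \<subseteq> X \<times> UNIV"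
  shows "\<exists>\<mu>'. extends X d \<mu> \<mu>' \<and> (\<exists>m>0. run \<mu>' v (concat (replicate m c)) = v)"
proof (cases "\<exists>m>0. run \<mu> v (concat (replicate m c)) = v")
  case True
  then show ?thesis
    using extends_refl[OF assms(1,2)] by blast
next
  case aperiodic: False
  interpret gluing X \<mu> by fact
  define n where "n = length c"
  have "c \<noteq> []"
    using c by (simp add: cyclically_reduced_def)
  then have "n > 0"
    by (simp add: n_def)
  define F where "F = cyc c"
  define G where "G = cyc (inv_word c)"
  define B where "B = Max (insert (length v) (length ` dom \<mu>))"
  have B: "length v \<le> B" "\<And>w. w \<in> dom \<mu> \<Longrightarrow> length w \<le> B"
    using assms(2) by (simp_all add: B_def)
  have F: "F i \<in> X \<times> UNIV" "F (Suc i) \<noteq> inv_letter (F i)" for i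
    using cyc_mem[OF \<open>c \<noteq> []\<close> c(2)] cyc_reduced[OF c(1)] by (simp_all add: F_def)
  have G: "G i \<in> X \<times> UNIV" "G (Suc i) \<noteq> inv_letter (G i)" for i
    using cyc_mem[of "inv_word c" "X \<times> UNIV"] \<open>c \<noteq> []\<close> c(2)
      cyc_reduced[OF cyclically_reduced_inv_word[OF c(1)]] by (simp_all add: G_def)
  have GF: "G i = inv_letter (F (N * n - Suc i))" if "i < N * n" for i N
    using cyc_inv_word[OF \<open>c \<noteq> []\<close>] that by (simp add: F_def G_def n_def)
  have "\<exists>i. B < length (run \<mu> v (map F [0..<i]))"
  proof (rule ccontr)
    assume "\<not> ?thesis"
    then have "length (run \<mu> v (map F [0..<i])) \<le> B" for i
      by (simp add: not_less)
    then show False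
      using bounded_orbit_periodic[OF assms(3) v \<open>c \<noteq> []\<close> c(2), of B] aperiodic
      unfolding F_def by blast
  qed
  from ray_escape[OF B(2,1) F(2) this] obtain a p where p: "length p = B"
      "\<And>k. run \<mu> v (map F [0..<a + k]) = p @ map F [a..<a + k]"
    by blast
  \<comment> \<open>A bounded backward orbit would make the inverse of \<open>c\<close> periodic at
    \<open>v\<close>, and with it \<open>c\<close>.\<close>
  have "\<exists>i. B < length (run \<mu> v (map G [0..<i]))"
  proof (rule ccontr)
    assume "\<not> ?thesis"
    then have bounded: "length (run \<mu> v (map G [0..<i])) \<le> B" for i
      by (simp add: not_less)
    have ne: "inv_word c \<noteq> []" "set (inv_word c) \<subseteq> X \<times> UNIV"
      using \<open>c \<noteq> []\<close> c(2) unfolding inv_word_mem by simp_all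
    from bounded_orbit_periodic[OF assms(3) v ne bounded[unfolded G_def]]
    obtain m where "m > 0" and m: "run \<mu> v (concat (replicate m (inv_word c))) = v"
      by blast
    have "set (concat (replicate m (inv_word c))) \<subseteq> X \<times> UNIV"
      using ne(2) by (auto simp del: inv_word_mem split: if_splits)
    from run_inv_word[OF v this] have "run \<mu> v (concat (replicate m c)) = v"
      by (simp add: m inv_word_power)
    then show False
      using aperiodic \<open>m > 0\<close> by blast
  qed
  from ray_escape[OF B(2,1) G(2) this] obtain b q where q: "length q = B"
      "\<And>k. run \<mu> v (map G [0..<b + k]) = q @ map G [b..<b + k]"
    by blast
  \<comment> \<open>Otherwise both rays reach the same position of \<open>c\<close> from opposite sides, where a letter would
    be its own inverse or be followed by its inverse.\<close>
  have "\<exists>j. F (a + j) \<noteq> G (b + j)"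
  proof (rule ccontr)
    assume "\<not> ?thesis"
    then have eq: "F (a + j) = G (b + j)" for j
      by auto
    \<comment> \<open>Any multiple of \<open>n\<close> above \<open>a + b\<close> serves. As
      \<open>G (b + j)\<close> is the inverse of \<open>F (a + e - j)\<close>, the two indices of
      \<open>F\<close> coincide or are adjacent when \<open>j\<close> is half of \<open>e\<close>,
      rounded down.\<close>
    define N where "N = a + b + 1"
    have "N \<le> N * n"
      using \<open>n > 0\<close> by simp
    then obtain e where e: "N * n = a + b + 1 + e"
      unfolding N_def using le_Suc_ex by blast
    show False
    proof (cases "even e")
      case True
      then obtain j where "e = 2 * j"
        by (elim evenE)
      then have "F (a + j) = inv_letter (F (a + j))"
        using eq[of j] GF[of "b + j" N] by (simp add: e algebra_simps)
      then show False
        by simp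
    next
      case False
      then obtain j where "e = 2 * j + 1"
        by (elim oddE)
      then have "F (a + j) = inv_letter (F (Suc (a + j)))"
        using eq[of j] GF[of "b + j" N] by (simp add: e algebra_simps)
      then show False
        using F(2)[of "a + j"] by simp
    qed
  qed
  then obtain j where j: "F (a + j) \<noteq> G (b + j)" ..
  obtain d1 where d1: "\<And>\<mu>'. agree d1 \<mu> \<mu>' \<Longrightarrow> run \<mu>' v (map F [0..<a]) = p"
    using run_agree[of \<mu> v "map F [0..<a]"] p(2)[of 0] by auto
  obtain d2 where d2: "\<And>\<mu>'. agree d2 \<mu> \<mu>' \<Longrightarrow> run \<mu>' v (map G [0..<b]) = q"
    using run_agree[of \<mu> v "map G [0..<b]"] q(2)[of 0] by auto
  \<comment> \<open>Agreement up to \<open>D\<close> keeps the runs to \<open>p\<close> and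
    \<open>q\<close>; all old cuts lie within \<open>D\<close>, and the last two summands pay for
    sparsity. The bound \<open>k > D\<close> puts the cuts beyond \<open>D\<close>, and
    \<open>k > j\<close> lets the rays differ before the cuts.\<close>
  define D where "D = d + d1 + d2 + B + card (dom \<mu>) + 2"
  define k where "k = j + D + 1"
  define N where "N = a + b + 2 * k + 2"
  have "N \<le> N * n"
    using \<open>n > 0\<close> by simp
  then have "a + b + 2 * k + 2 \<le> N * n"
    by (simp only: N_def)
  \<comment> \<open>The equation makes \<open>G (b + k')\<close> the inverse of
    \<open>F (a + k)\<close>, so the cut edges carry inverse labels, and \<open>a + k + 1\<close>
    letters forwards and \<open>b + k'\<close> letters backwards make up \<open>N\<close> copies of
    \<open>c\<close>.\<close>
  then obtain k' where Nn: "N * n = a + b + k + k' + 1" "k < k'"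
    using that[of "N * n - (a + b + k + 1)"] by linarith
  define w where "w = p @ map F [a..<a + Suc k]"
  define w' where "w' = q @ map G [b..<b + Suc k']"
  have w_verts: "w \<in> verts X \<mu>" "w' \<in> verts X \<mu>"
    unfolding w_def w'_def p(2)[symmetric] q(2)[symmetric]
    using F(1) G(1) by (intro run_verts[OF v]; simp add: image_subset_iff del: mem_Times_iff upt_Suc)+
  have w_snoc: "w = butlast w @ [F (a + k)]" "w' = butlast w' @ [inv_letter (F (a + k))]"
    using GF[of "b + k'" N] Nn by (simp_all add: w_def w'_def butlast_append)
  have w_last: "last w = F (a + k)" "last w' = inv_letter (F (a + k))"
    by (subst w_snoc, rule last_snoc)+
  have len: "length w = B + Suc k" "length w' = B + Suc k'"
    by (simp_all add: w_def w'_def p(1) q(1))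
  have "w ! (B + j) = F (a + j)" "w' ! (B + j) = G (b + j)"
    using p(1) q(1) Nn(2) by (auto simp: w_def w'_def nth_append k_def simp del: upt_Suc)
  then have differ: "w ! (B + j) \<noteq> w' ! (B + j)"
    using j by simp
  define f where "f x = (if x = w then w' else w)" for x
  define \<mu>' where "\<mu>' = (\<lambda>x. if x \<in> {w, w'} then Some (f x) else \<mu> x)"
  have ext: "extends X D \<mu> \<mu>'"
    unfolding \<mu>'_def
  proof (rule gluing_extend)
    show "inj_on butlast {w, w'}"
      using differ nth_butlast[of "B + j" w] nth_butlast[of "B + j" w'] len Nn(2)
      by (auto simp: k_def)
    show "prefix x x' \<Longrightarrow> x = x'" if "x \<in> {w, w'}" "x' \<in> {w, w'}" for x x'
      using that differ len Nn(2) prefix_nth[of w w' "B + j"] prefix_nth[of w' w "B + j"]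
      by (auto simp: k_def)
    show "last (f x) = inv_letter (last x)" if "x \<in> {w, w'}" for x
      using that w_last by (auto simp: f_def)
    have "card {w, w'} \<le> 2"
      by (simp add: card_insert_if)
    then show "card (dom \<mu>) + card {w, w'} \<le> D"
      by (simp add: D_def)
  qed (use assms w_verts len Nn(2) B(2) in \<open>force simp: f_def k_def D_def\<close>)+
  interpret g': gluing X \<mu>'
    using ext by (simp add: extends_def)
  have glued: "\<mu>' w = Some w'" "\<mu>' w' = Some w"
    by (auto simp: \<mu>'_def f_def)
  have agr: "agree D \<mu> \<mu>'"
    using ext by (simp add: extends_def)
  have v': "v \<in> verts X \<mu>'"
    using v agree_verts[OF agr, of v] B(1) by (simp add: D_def)
  have "run \<mu>' p (map F [a..<a + k]) = butlast w"
    using run_push[of p "map F [a..<a + k]" X \<mu>'] g'.butlast_glued_verts[OF glued(1)]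
    by (simp add: w_def butlast_append)
  then have "run \<mu>' v (map F [0..<a + k]) = butlast w"
    using d1[of \<mu>'] agree_mono[OF agr, of d1] by (simp add: D_def upt_add_eq_append[of 0])
  moreover have "step \<mu>' (butlast w) (F (a + k)) = butlast w'"
    using w_verts(1) w_snoc(1) glued(1) step_glued[of "butlast w" "F (a + k)" X \<mu>] by simp
  ultimately have forward: "run \<mu>' v (map F [0..<a + k + 1]) = butlast w'"
    by simp
  have "run \<mu>' q (map G [b..<b + k']) = butlast w'"
    using run_push[of q "map G [b..<b + k']" X \<mu>'] g'.butlast_glued_verts[OF glued(2)]
    by (simp add: w'_def butlast_append)
  then have backward: "run \<mu>' v (map G [0..<b + k']) = butlast w'"
    using d2[of \<mu>'] agree_mono[OF agr, of d2] by (simp add: D_def upt_add_eq_append[of 0])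
  \<comment> \<open>The part of the power of \<open>c\<close> left after the new edge is the
    backward path traversed in reverse, so it returns to \<open>v\<close>.\<close>
  have "inv_word (map G [0..<b + k']) = map F [a + k + 1..<N * n]"
    using Nn by (intro nth_equalityI) (auto simp: nth_inv_word GF[of _ N] add.assoc simp del: upt_Suc)
  moreover have "set (map G [0..<b + k']) \<subseteq> X \<times> UNIV"
    using G(1) by (simp add: image_subset_iff del: mem_Times_iff)
  ultimately have "run \<mu>' (butlast w') (map F [a + k + 1..<N * n]) = v"
    using g'.run_inv_word[OF v', of "map G [0..<b + k']"] backward by simp
  moreover have "[0..<N * n] = [0..<a + k + 1] @ [a + k + 1..<N * n]"
    using Nn upt_add_eq_append[of 0 "a + k + 1" "b + k'"] by (simp add: algebra_simps)
  ultimately have "run \<mu>' v (map F [0..<N * n]) = v"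
    using forward by simp
  then have "run \<mu>' v (concat (replicate N c)) = v"
    unfolding F_def n_def map_cyc .
  moreover have "N > 0"
    by (simp add: N_def)
  moreover have "extends X d \<mu> \<mu>'"
    using extends_mono[OF ext] by (simp add: D_def)
  ultimately show ?thesis
    by blast
qed

section \<open>Escaping beyond the cuts and transposing vertices\<close>

context gluing
begin

text \<open>Of at least four letters at most three are excluded: \<open>k\<close>, the letter that
  backtracks, and the letter of the cut at \<open>v\<close>, which is unique by
  \<open>glued_butlast\<close>.\<close>

lemma push_letter:
  assumes "finite X" "card X \<ge> 2" "v \<in> verts X \<mu>"
  shows "\<exists>l. l \<noteq> k \<and> v @ [l] \<in> verts X \<mu>"
proof -
  obtain k' where k': "\<And>l. \<mu> (v @ [l]) \<noteq> None \<Longrightarrow> l = k'"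
    using glued_butlast by (metis butlast_snoc last_snoc)
  have "card {k, inv_letter (last v), k'} \<le> 3"
    by (simp add: card_insert_if)
  also have "3 < card (X \<times> (UNIV :: bool set))"
    using assms(2) by (simp add: card_cartesian_product)
  finally have "\<not> X \<times> UNIV \<subseteq> {k, inv_letter (last v), k'}"
    using card_mono[of "{k, inv_letter (last v), k'}" "X \<times> (UNIV :: bool set)"] by auto
  then obtain l where l: "l \<in> X \<times> UNIV" "l \<noteq> k" "l \<noteq> inv_letter (last v)" "l \<noteq> k'"
    by blast
  then have "v @ [l] \<in> verts X \<mu>"
    using assms(3) k' unfolding verts_snoc by (metis inv_letter_inv_letter)
  then show ?thesis
    using l by blast
qed

lemma push_word:
  assumes "finite X" "card X \<ge> 2" "v \<in> verts X \<mu>"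
  shows "\<exists>u. length u = Suc n \<and> hd u \<noteq> k \<and> v @ u \<in> verts X \<mu>"
proof (induction n)
  case 0
  obtain l where "l \<noteq> k" "v @ [l] \<in> verts X \<mu>"
    using push_letter[OF assms] by blast
  then show ?case
    by (intro exI[of _ "[l]"]) simp
next
  case (Suc n)
  then obtain u where u: "length u = Suc n" "hd u \<noteq> k" "v @ u \<in> verts X \<mu>"
    by blast
  then obtain l where "(v @ u) @ [l] \<in> verts X \<mu>"
    using push_letter[OF assms(1,2)] by blast
  moreover have "hd (u @ [l]) = hd u"
    using u(1) by (cases u) auto
  ultimately show ?case
    using u by (intro exI[of _ "u @ [l]"]) simp
qed

text \<open>The points are driven out one after another. A prolongation that suits the new point
  does no harm to those that have already escaped: they sit beyond all cuts with the common last
  letter \<open>last u\<close>, which the prolongation does not cancel.\<close>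

lemma escape_word:
  assumes "finite X" "card X \<ge> 2" and short: "\<And>w. w \<in> dom \<mu> \<Longrightarrow> length w \<le> B"
    and "finite Z" "Z \<subseteq> verts X \<mu>"
  shows "\<exists>u. u \<noteq> [] \<and> set u \<subseteq> X \<times> UNIV \<and>
    (\<forall>z\<in>Z. B < length (run \<mu> z u) \<and> last (run \<mu> z u) = last u)"
  using assms(4,5)
proof (induction Z)
  case empty
  obtain x where "x \<in> X"
    using assms(2) by fastforce
  then show ?case
    by (intro exI[of _ "[(x, True)]"]) simp
next
  case (insert z Z)
  then obtain u where u: "u \<noteq> []" "set u \<subseteq> X \<times> UNIV"
      "\<And>z. z \<in> Z \<Longrightarrow> B < length (run \<mu> z u) \<and> last (run \<mu> z u) = last u"
    by auto
  have z: "run \<mu> z u \<in> verts X \<mu>"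
    using insert.prems run_verts u(2) by auto
  obtain u' where u': "length u' = Suc B" "hd u' \<noteq> inv_letter (last u)" "run \<mu> z u @ u' \<in> verts X \<mu>"
    using push_word[OF assms(1,2) z] by blast
  have "u' \<noteq> []"
    using u'(1) by auto
  have mem: "set u' \<subseteq> X \<times> UNIV" "reduced u'"
    using u'(3) by (auto simp: verts_def reduced_words_eq successively_append_iff)
  have "B < length (run \<mu> y (u @ u')) \<and> last (run \<mu> y (u @ u')) = last u'" if "y \<in> insert z Z" for y
  proof -
    have "run \<mu> y u @ u' \<in> verts X \<mu>"
    proof (cases "y = z")
      case False
      then have "y \<in> Z"
        using that by simp
      then have y: "run \<mu> y u \<in> verts X \<mu>" "B < length (run \<mu> y u)" "last (run \<mu> y u) = last u"
        using insert.prems run_verts u by auto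
      moreover have "run \<mu> y u @ u' \<in> reduced_words X"
        using y mem u'(2) by (auto simp: verts_def reduced_words_eq successively_append_iff)
      ultimately show ?thesis
        using short by (intro verts_append_long) (auto simp: dom_def intro: less_imp_le order.strict_trans1)
    qed (use u' in simp)
    then show ?thesis
      using run_push[of "run \<mu> y u" u' X \<mu>] u'(1) \<open>u' \<noteq> []\<close> by simp
  qed
  then show ?case
    using \<open>u' \<noteq> []\<close> u(2) mem(1) by (intro exI[of _ "u @ u'"]) auto
qed

end

text \<open>The long block of letters \<open>e\<close> makes the position of \<open>s\<close> recover the length of \<open>p\<close>.\<close>

lemma marker_prefix:
  assumes "prefix (p @ replicate n e @ [s, s']) (q @ replicate n e @ [t, t'])"
    and "length q < n" "s \<noteq> e"
  shows "p = q" "s = t" "s' = t'"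
proof -
  have "length p \<le> length q"
    using prefix_length_le[OF assms(1)] by simp
  moreover have "\<not> length p < length q"
  proof
    assume "length p < length q"
    moreover have "(p @ replicate n e @ [s, s']) ! (length p + n) = s"
      by (simp add: nth_append)
    moreover have "(q @ replicate n e @ [t, t']) ! (length p + n) = (p @ replicate n e @ [s, s']) ! (length p + n)"
      using prefix_nth[OF assms(1), of "length p + n"] by simp
    ultimately show False
      using assms(2,3) by (simp add: nth_append split: if_splits)
  qed
  ultimately have "length p = length q"
    by simp
  then have "p @ replicate n e @ [s, s'] = q @ replicate n e @ [t, t']"
    using assms(1) by (auto simp: prefix_def)
  then show "p = q" "s = t" "s' = t'"
    using \<open>length p = length q\<close> by auto
qed

text \<open>Density of the transposition condition. The word \<alpha> takes \<open>z\<close> to a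
  far vertex of its own ending in \<open>b\<close>, a new edge labelled \<open>e\<close> leads to
  the vertex of \<open>\<pi> z\<close> ending in \<open>inv_letter b\<close>, and \<beta> read
  backwards leads from there to \<open>\<pi> z\<close>. The two end letters keep sources and targets
  of new edges apart, so that no vertex carries two cuts.\<close>

proposition swap_vertices:
  assumes "gluing X \<mu>" "finite (dom \<mu>)" "finite X" "card X \<ge> 2"
    and Z: "finite Z" "Z \<subseteq> verts X \<mu>" and xy: "x \<in> Z" "y \<in> Z"
  shows "\<exists>\<mu>'. extends X d \<mu> \<mu>' \<and>
    (\<exists>u. set u \<subseteq> X \<times> UNIV \<and> (\<forall>z\<in>Z. run \<mu>' z u = (if z = x then y else if z = y then x else z)))"
proof -
  interpret gluing X \<mu> by fact
  define \<pi> where "\<pi> z = (if z = x then y else if z = y then x else z)" for z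
  have \<pi>: "\<pi> z \<in> Z" "\<pi> (\<pi> z) = z" if "z \<in> Z" for z
    using that xy by (auto simp: \<pi>_def)
  define B where "B = Max (length ` dom \<mu> \<union> length ` Z)"
  have B: "length w \<le> B" if "w \<in> dom \<mu> \<or> w \<in> Z" for w
    unfolding B_def using assms(2) Z(1) that by (intro Max_ge) auto
  obtain u where u: "u \<noteq> []" "set u \<subseteq> X \<times> UNIV"
      "\<And>z. z \<in> Z \<Longrightarrow> B < length (run \<mu> z u) \<and> last (run \<mu> z u) = last u"
    using escape_word[OF assms(3,4) B Z] by auto
  define e where "e = last u"
  have e: "e \<in> X \<times> UNIV"
    using u(1,2) by (auto simp: e_def)
  \<comment> \<open>A second generator makes \<open>b\<close> differ from \<open>e\<close> and its
    inverse, so the block of letters \<open>e\<close> ends visibly and the words stay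
    reduced.\<close>
  obtain t where t: "t \<in> X" "t \<noteq> fst e"
    using assms(4) by (metis card_2_iff' card_le_Suc0_iff_eq assms(3) not_less_eq_eq numeral_2_eq_2)
  define b where "b = (t, True)"
  have b: "b \<in> X \<times> UNIV" "b \<noteq> e" "b \<noteq> inv_letter e" "inv_letter b \<noteq> e"
    using t by (auto simp: b_def inv_letter_def)
  define \<Lambda> where "\<Lambda> = Max (length ` (\<lambda>z. run \<mu> z u) ` Z)"
  have \<Lambda>: "length (run \<mu> z u) \<le> \<Lambda>" if "z \<in> Z" for z
    using Z(1) that by (simp add: \<Lambda>_def)
  obtain d' where d': "\<And>\<mu>' z. agree d' \<mu> \<mu>' \<Longrightarrow> z \<in> Z \<Longrightarrow> run \<mu>' z u = run \<mu> z u"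
    using run_agree_finite[of "Z \<times> {u}" \<mu>] Z(1) by auto
  \<comment> \<open>Agreement up to \<open>d'\<close> preserves the runs along \<open>u\<close>, all
    cuts and points of \<open>Z\<close> lie within \<open>B\<close>, \<Lambda> makes the block
    longer than every run before it, and the last two summands pay for sparsity.\<close>
  define D where "D = d + d' + B + \<Lambda> + card (dom \<mu>) + 2 * card Z"
  define P where "P z = run \<mu> z u @ replicate (Suc D) e" for z
  define \<sigma> where "\<sigma> z = run \<mu> z u @ replicate (Suc D) e @ [b, e]" for z
  define \<tau> where "\<tau> z = run \<mu> z u @ replicate (Suc D) e @ [inv_letter b, inv_letter e]" for z
  have short: "length (run \<mu> z u) < Suc D" if "z \<in> Z" for z
    using \<Lambda>[OF that] by (simp add: D_def)
  have mem: "run \<mu> z u \<in> verts X \<mu>" if "z \<in> Z" for z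
    using that u(2) Z(2) run_verts by auto
  have "run \<mu> z u @ replicate (Suc D) e @ [s, s'] \<in> verts X \<mu>"
    if "z \<in> Z" "s \<in> X \<times> UNIV" "s' \<in> X \<times> UNIV" "s \<noteq> inv_letter e" "s' \<noteq> inv_letter s" for z s s'
  proof (rule verts_append_long)
    have "reduced (replicate n e)" for n
      by (simp add: successively_conv_nth)
    then show "run \<mu> z u @ replicate (Suc D) e @ [s, s'] \<in> reduced_words X"
      using that e mem[OF that(1)] u(3)[OF that(1)]
      by (auto simp: verts_def reduced_words_eq successively_append_iff e_def simp del: replicate_Suc)
    show "length w \<le> length (run \<mu> z u)" if "\<mu> w \<noteq> None" for w
      using B[of w] u(3)[OF \<open>z \<in> Z\<close>] that by (auto simp: dom_def)
  qed (rule mem[OF that(1)])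
  then have verts: "\<sigma> z \<in> verts X \<mu>" "\<tau> z \<in> verts X \<mu>" if "z \<in> Z" for z
    using that b e by (simp_all add: \<sigma>_def \<tau>_def del: mem_Times_iff replicate_Suc)
  have run_u_inj: "z = z'" if "run \<mu> z u = run \<mu> z' u" "z \<in> Z" "z' \<in> Z" for z z'
    using run_inj[OF _ _ u(2) that(1)] that Z(2) by auto
  then have inj: "inj_on \<sigma> Z" "inj_on \<tau> Z"
    by (auto intro!: inj_onI simp: \<sigma>_def \<tau>_def)
  have last: "last (\<sigma> z) = e" "last (\<tau> z) = inv_letter e" for z
    by (simp_all add: \<sigma>_def \<tau>_def)
  have disj: "\<tau> z \<notin> \<sigma> ` Z" for z
    using last by (metis imageE inv_letter_neq(1))
  define C where "C = \<sigma> ` Z \<union> \<tau> ` Z"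
  \<comment> \<open>The new edges, labelled \<open>e\<close>, lead from \<open>P z @ [b]\<close> to \<open>P (\<pi> z) @ [inv_letter b]\<close>.\<close>
  define f where "f w = (if w \<in> \<sigma> ` Z then \<tau> (\<pi> (inv_into Z \<sigma> w)) else \<sigma> (\<pi> (inv_into Z \<tau> w)))" for w
  have f: "f (\<sigma> z) = \<tau> (\<pi> z)" "f (\<tau> z) = \<sigma> (\<pi> z)" if "z \<in> Z" for z
    using that disj inj by (simp_all add: f_def)
  \<comment> \<open>All new words have the shape required by \<open>marker_prefix\<close>. The last
    letter is determined by the one before it, which makes \<open>butlast\<close> injective on
    them.\<close>
  have C_cases: "\<exists>z s s'. z \<in> Z \<and> s \<noteq> e \<and> w = run \<mu> z u @ replicate (Suc D) e @ [s, s'] \<and>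
      (s' = e \<and> s = b \<or> s' = inv_letter e \<and> s = inv_letter b)" if "w \<in> C" for w
  proof -
    from that obtain z where "z \<in> Z" "w = \<sigma> z \<or> w = \<tau> z"
      by (auto simp: C_def)
    then show ?thesis
      using b(2,4) unfolding \<sigma>_def \<tau>_def by blast
  qed
  define \<mu>' where "\<mu>' = (\<lambda>w. if w \<in> C then Some (f w) else \<mu> w)"
  have ext: "extends X D \<mu> \<mu>'"
    unfolding \<mu>'_def
  proof (rule gluing_extend)
    show "w = w'" if ww': "w \<in> C" "w' \<in> C" "prefix w w'" for w w'
    proof -
      obtain z s s' where w: "z \<in> Z" "s \<noteq> e" "w = run \<mu> z u @ replicate (Suc D) e @ [s, s']"
        using C_cases[OF ww'(1)] by blast
      obtain z' t t' where w': "z' \<in> Z" "w' = run \<mu> z' u @ replicate (Suc D) e @ [t, t']"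
        using C_cases[OF ww'(2)] by blast
      show ?thesis
        using marker_prefix[OF ww'(3)[unfolded w(3) w'(2)] short[OF w'(1)] w(2)] w(3) w'(2) by simp
    qed
    show "inj_on butlast C"
    proof (rule inj_onI)
      fix w w' assume ww': "w \<in> C" "w' \<in> C" "butlast w = butlast w'"
      obtain z s s' where w: "z \<in> Z" "s \<noteq> e" "w = run \<mu> z u @ replicate (Suc D) e @ [s, s']"
          "s' = e \<and> s = b \<or> s' = inv_letter e \<and> s = inv_letter b"
        using C_cases[OF ww'(1)] by blast
      obtain z' t t' where w': "z' \<in> Z" "w' = run \<mu> z' u @ replicate (Suc D) e @ [t, t']"
          "t' = e \<and> t = b \<or> t' = inv_letter e \<and> t = inv_letter b"
        using C_cases[OF ww'(2)] by blast
      have "run \<mu> z u @ replicate (Suc D) e @ [s] = run \<mu> z' u @ replicate (Suc D) e @ [t]"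
        using ww'(3) by (simp add: w(3) w'(2) butlast_append del: replicate_Suc)
      then have "run \<mu> z u = run \<mu> z' u" "s = t"
        by auto
      then show "w = w'"
        using w w' by auto
    qed
    have "card C \<le> card Z + card Z"
      unfolding C_def by (rule order.trans[OF card_Un_le]) (simp add: add_mono card_image_le Z(1))
    then show "card (dom \<mu>) + card C \<le> D"
      by (simp add: D_def)
    show "D < length w" if "w \<in> C" for w
      using that by (auto simp: C_def \<sigma>_def \<tau>_def)
    show "length w \<le> D" if "w \<in> dom \<mu>" for w
      using B that by (force simp: D_def)
    show "f w \<in> C" "f (f w) = w" "last (f w) = inv_letter (last w)" if "w \<in> C" for w
      using that f \<pi> last by (auto simp: C_def)
    show "C \<subseteq> verts X \<mu>"
      using verts by (auto simp: C_def)
    show "finite C"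
      using Z(1) by (simp add: C_def)
  qed (use assms in auto)
  interpret g': gluing X \<mu>'
    using ext by (simp add: extends_def)
  have agr: "agree D \<mu> \<mu>'"
    using ext by (simp add: extends_def)
  have glued: "\<mu>' (\<sigma> z) = Some (\<tau> (\<pi> z))" "\<mu>' (\<tau> z) = Some (\<sigma> (\<pi> z))" if "z \<in> Z" for z
    using that f by (simp_all add: \<mu>'_def C_def)
  have run: "run \<mu>' z (u @ replicate (Suc D) e @ [s]) = P z @ [s]"
    if "z \<in> Z" "P z @ [s] \<in> verts X \<mu>'" for z s
  proof -
    have "run \<mu>' z u = run \<mu> z u"
      using d' that(1) agree_mono[OF agr, of d'] by (simp add: D_def)
    then show ?thesis
      using run_push[of "run \<mu> z u" "replicate (Suc D) e @ [s]" X \<mu>'] that(2)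
      by (simp add: P_def del: replicate_Suc)
  qed
  have butlast: "butlast (\<sigma> z) = P z @ [b]" "butlast (\<tau> z) = P z @ [inv_letter b]" for z
    by (simp_all add: \<sigma>_def \<tau>_def P_def butlast_append del: replicate_Suc)
  define \<alpha> where "\<alpha> = u @ replicate (Suc D) e @ [b]"
  define \<beta> where "\<beta> = u @ replicate (Suc D) e @ [inv_letter b]"
  have set: "set \<alpha> \<subseteq> X \<times> UNIV" "set \<beta> \<subseteq> X \<times> UNIV"
    using u(2) e b(1) by (auto simp: \<alpha>_def \<beta>_def)
  \<comment> \<open>Out along \<alpha>, across the new edge, and back along the path by which
    \<beta> leads out of \<open>\<pi> z\<close>.\<close>
  have "run \<mu>' z (\<alpha> @ [e] @ inv_word \<beta>) = \<pi> z" if "z \<in> Z" for z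
  proof -
    have "run \<mu>' z \<alpha> = P z @ [b]"
      unfolding \<alpha>_def using run[OF that] g'.butlast_glued_verts[OF glued(1)[OF that]] butlast by simp
    moreover have "step \<mu>' (P z @ [b]) e = P (\<pi> z) @ [inv_letter b]"
      using step_glued[of "P z @ [b]" e X \<mu>] verts(1)[OF that] glued(1)[OF that] butlast
      by (simp add: P_def \<sigma>_def del: replicate_Suc)
    moreover have "run \<mu>' (\<pi> z) \<beta> = P (\<pi> z) @ [inv_letter b]"
      unfolding \<beta>_def
      using run[OF \<pi>(1)[OF that]] g'.butlast_glued_verts[OF glued(2)[OF \<pi>(1)[OF that]]] butlast by simp
    moreover have "\<pi> z \<in> verts X \<mu>'"
      using agree_verts[OF agr, of "\<pi> z"] \<pi>(1)[OF that] Z(2) B by (force simp: D_def)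
    ultimately show ?thesis
      using g'.run_inv_word[of "\<pi> z" \<beta>] set(2) by simp
  qed
  moreover have "set (\<alpha> @ [e] @ inv_word \<beta>) \<subseteq> X \<times> UNIV"
    using set e inv_word_mem[of \<beta> X] by simp
  moreover have "extends X d \<mu> \<mu>'"
    using extends_mono[OF ext] by (simp add: D_def)
  ultimately show ?thesis
    unfolding \<pi>_def by blast
qed

section \<open>The limit action\<close>

text \<open>A Baire category argument for countably many open conditions that are dense among the
  finite gluings. Each step meets one condition and freezes the gluing up to a level that guarantees
  it for ever.\<close>

proposition generic_gluing:
  assumes "countable \<Q>"
    and dense: "\<And>Q \<mu> d. Q \<in> \<Q> \<Longrightarrow> gluing X \<mu> \<Longrightarrow> finite (dom \<mu>) \<Longrightarrow> \<exists>\<mu>'. extends X d \<mu> \<mu>' \<and> Q \<mu>'"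
    and "open": "\<And>Q \<mu>. Q \<in> \<Q> \<Longrightarrow> Q \<mu> \<Longrightarrow> \<exists>d. \<forall>\<mu>'. agree d \<mu> \<mu>' \<longrightarrow> Q \<mu>'"
    and "\<Q> \<noteq> {}"
  shows "\<exists>\<mu>. gluing X \<mu> \<and> (\<forall>Q\<in>\<Q>. Q \<mu>)"
proof -
  define q where "q = from_nat_into \<Q>"
  have q: "q n \<in> \<Q>" for n
    using assms(4) by (simp add: q_def from_nat_into)
  \<comment> \<open>A state pairs a finite gluing with the level up to which it is frozen;
    \<open>n \<le> snd s\<close> makes these levels tend to infinity.\<close>
  define P where "P n s \<longleftrightarrow> gluing X (fst s) \<and> finite (dom (fst s)) \<and> n \<le> snd s" for n :: nat and s
  define R where "R n s s' \<longleftrightarrow> agree (snd s) (fst s) (fst s') \<and> snd s \<le> snd s' \<and>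
    (\<forall>\<mu>. agree (snd s') (fst s') \<mu> \<longrightarrow> q n \<mu>)" for n s s'
  have "gluing X (\<lambda>_. None)"
    by standard auto
  then have init: "\<exists>s. P 0 s"
    by (intro exI[of _ "(\<lambda>_. None, 0)"]) (simp add: P_def)
  have next_state: "\<exists>s'. P (Suc n) s' \<and> R n s s'" if state: "P n s" for n s
  proof -
    obtain \<mu>' where \<mu>': "extends X (snd s) (fst s) \<mu>'" "q n \<mu>'"
      using dense[OF q, of "fst s" "snd s" n] state by (auto simp: P_def)
    obtain d where d: "\<And>\<mu>. agree d \<mu>' \<mu> \<Longrightarrow> q n \<mu>"
      using "open"[OF q \<mu>'(2)] by blast
    \<comment> \<open>The level \<open>d\<close> secures the condition just met,
      \<open>snd s\<close> preserves what was frozen before, and \<open>Suc n\<close> forces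
      growth.\<close>
    define d' where "d' = max (max d (snd s)) (Suc n)"
    have "q n \<mu>" if "agree d' \<mu>' \<mu>" for \<mu>
      using d agree_mono[OF that, of d] by (simp add: d'_def)
    then have "P (Suc n) (\<mu>', d') \<and> R n s (\<mu>', d')"
      using \<mu>'(1) by (simp add: P_def R_def extends_def) (simp add: d'_def)
    then show ?thesis
      by blast
  qed
  obtain s where s: "\<And>n. P n (s n)" "\<And>n. R n (s n) (s (Suc n))"
    using dependent_nat_choice[of P R] init next_state by blast
  define \<mu> where "\<mu> n = fst (s n)" for n
  define d where "d n = snd (s n)" for n
  have gl: "gluing X (\<mu> n)" and d: "n \<le> d n" and d_Suc: "d n \<le> d (Suc n)"
    and agr: "agree (d n) (\<mu> n) (\<mu> (Suc n))"
    and Qn: "agree (d (Suc n)) (\<mu> (Suc n)) \<mu>' \<Longrightarrow> q n \<mu>'" for n \<mu>'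
    using s[of n] by (auto simp: P_def R_def \<mu>_def d_def)
  have agr_le: "d i \<le> d j \<and> agree (d i) (\<mu> i) (\<mu> j)" if "i \<le> j" for i j
    using that
  proof (induction j rule: dec_induct)
    case (step j)
    then show ?case
      using d_Suc[of j] agr[of j] by (auto simp: agree_def)
  qed (simp add: agree_def)
  \<comment> \<open>By stage \<open>length w\<close> the value at \<open>w\<close> is final, since
    \<open>n \<le> d n\<close>.\<close>
  define \<nu> where "\<nu> w = \<mu> (length w) w" for w
  have limit: "agree (d i) (\<mu> i) \<nu>" for i
    unfolding agree_def
  proof (intro allI impI)
    fix w :: "'a word" assume w: "length w \<le> d i"
    show "\<nu> w = \<mu> i w"
      using agr_le[of i "length w"] agr_le[of "length w" i] d[of "length w"] w
      by (cases "i \<le> length w") (simp_all add: agree_def \<nu>_def)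
  qed
  have \<nu>: "\<nu> w = \<mu> i w" if "length w \<le> i" for w i
    using limit[of i] d[of i] that by (simp add: agree_def)
  have "gluing X \<nu>"
  proof
    fix w w' :: "'a word"
    \<comment> \<open>Apart from sparsity each axiom involves at most two words and is inherited
      from a stage late enough for both.\<close>
    define i where "i = max (length w) (length w')"
    interpret g: gluing X "\<mu> i"
      by (rule gl)
    have eq: "\<nu> w = \<mu> i w" "\<nu> w' = \<mu> i w'"
      by (simp_all add: \<nu> i_def)
    show "w \<in> reduced_words X" "\<nu> w' = Some w" "last w' = inv_letter (last w)" if "\<nu> w = Some w'"
      using that g.glued_reduced g.glued_sym g.glued_last unfolding eq by blast+
    show "w = w'" if "\<nu> w \<noteq> None" "\<nu> w' \<noteq> None" "prefix w w'"
      using that g.glued_prefix unfolding eq by blast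
    show "w = w'" if "\<nu> w \<noteq> None" "\<nu> w' \<noteq> None" "butlast w = butlast w'"
      using that g.glued_butlast unfolding eq by blast
  next
    show "\<nu> [] = None"
      using gluing.glued_nonempty[OF gl] by (simp add: \<nu>_def)
    fix n
    have "{w \<in> dom \<nu>. length w = Suc n} = {w \<in> dom (\<mu> (Suc n)). length w = Suc n}"
      by (auto simp: dom_def \<nu>_def)
    then show "card {w \<in> dom \<nu>. length w = Suc n} \<le> n"
      using gluing.glued_sparse[OF gl, of "Suc n" n] by simp
  qed
  moreover have "Q \<nu>" if "Q \<in> \<Q>" for Q
  proof -
    have "\<exists>n. q n = Q"
      using from_nat_into_surj[OF assms(1) that] unfolding q_def .
    then obtain n where "Q = q n"
      by auto
    show ?thesis
      unfolding \<open>Q = q n\<close> by (rule Qn[OF limit])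
  qed
  ultimately show ?thesis
    by (intro exI[of _ \<nu>] conjI ballI)
qed

text \<open>The conditions are indexed by arbitrary words, and by lists in place of finite sets, to
  have countably many. The vertices of the limit are unknown in advance, so vertex hypotheses become
  premises inside \<open>Q1\<close> and \<open>Q2\<close>. The conditions are open because runs, and
  being or not being a vertex, are settled by boundedly many levels.\<close>

proposition periodic_highly_transitive_gluing:
  assumes "finite X" "card X \<ge> 2"
  shows "\<exists>\<mu>. gluing X \<mu> \<and>
    (\<forall>v\<in>verts X \<mu>. \<forall>c. cyclically_reduced c \<longrightarrow> set c \<subseteq> X \<times> UNIV \<longrightarrow>
        (\<exists>m>0. run \<mu> v (concat (replicate m c)) = v)) \<and>
    (\<forall>Z x y. finite Z \<longrightarrow> Z \<subseteq> verts X \<mu> \<longrightarrow> x \<in> Z \<longrightarrow> y \<in> Z \<longrightarrow>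
        (\<exists>u. set u \<subseteq> X \<times> UNIV \<and> (\<forall>z\<in>Z. run \<mu> z u = (if z = x then y else if z = y then x else z))))"
proof -
  define L where "L = X \<times> (UNIV :: bool set)"
  define Q1 where "Q1 v c \<mu> \<longleftrightarrow> v \<in> verts X \<mu> \<longrightarrow> (\<exists>m>0. run \<mu> v (concat (replicate m c)) = v)"
    for v c \<mu>
  define Q2 where "Q2 zs x y \<mu> \<longleftrightarrow> set zs \<subseteq> verts X \<mu> \<longrightarrow>
      (\<exists>u. set u \<subseteq> X \<times> UNIV \<and> (\<forall>z\<in>set zs. run \<mu> z u = (if z = x then y else if z = y then x else z)))"
    for zs x y \<mu>
  define T1 where "T1 = lists L \<times> {c \<in> lists L. cyclically_reduced c}"
  define T2 where "T2 = {(zs, x, y) \<in> lists (lists L) \<times> lists L \<times> lists L. x \<in> set zs \<and> y \<in> set zs}"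
  define \<Q> where "\<Q> = (\<lambda>(v, c). Q1 v c) ` T1 \<union> (\<lambda>(zs, x, y). Q2 zs x y) ` T2"
  have "countable (lists L)" "countable (lists (lists L))"
    using assms(1) by (simp_all add: L_def countable_finite)
  then have "countable (lists L \<times> lists L)" "countable (lists (lists L) \<times> lists L \<times> lists L)"
    by (auto intro!: countable_SIGMA)
  moreover have "T1 \<subseteq> lists L \<times> lists L" "T2 \<subseteq> lists (lists L) \<times> lists L \<times> lists L"
    by (auto simp: T1_def T2_def)
  ultimately have "countable T1" "countable T2"
    by (meson countable_subset)+
  then have "countable \<Q>"
    by (simp add: \<Q>_def)
  moreover have "\<exists>\<mu>'. extends X d \<mu> \<mu>' \<and> Q \<mu>'"
    if "Q \<in> \<Q>" and gl: "gluing X \<mu>" "finite (dom \<mu>)" for Q \<mu> d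
  proof -
    from that(1) consider v c where "Q = Q1 v c" "(v, c) \<in> T1" | zs x y where "Q = Q2 zs x y" "(zs, x, y) \<in> T2"
      by (auto simp: \<Q>_def)
    then show ?thesis
    proof cases
      case 1
      show ?thesis
      proof (cases "v \<in> verts X \<mu>")
        case True
        have "cyclically_reduced c" "set c \<subseteq> X \<times> UNIV"
          using 1 by (auto simp: T1_def L_def)
        from close_orbit[OF gl assms(1) True this] show ?thesis
          unfolding 1 Q1_def by blast
      next
        case False
        then show ?thesis
          using extends_refl[OF gl] unfolding 1 Q1_def by blast
      qed
    next
      case 2
      show ?thesis
      proof (cases "set zs \<subseteq> verts X \<mu>")
        case True
        have "x \<in> set zs" "y \<in> set zs"
          using 2 by (auto simp: T2_def)
        from swap_vertices[OF gl assms finite_set True this] show ?thesis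
          unfolding 2 Q2_def by blast
      next
        case False
        then show ?thesis
          using extends_refl[OF gl] unfolding 2 Q2_def by blast
      qed
    qed
  qed
  moreover have "\<exists>d. \<forall>\<mu>'. agree d \<mu> \<mu>' \<longrightarrow> Q \<mu>'" if Q: "Q \<in> \<Q>" "Q \<mu>" for Q \<mu>
  proof -
    from Q(1) consider v c where "Q = Q1 v c" | zs x y where "Q = Q2 zs x y"
      by (auto simp: \<Q>_def)
    then show ?thesis
    proof cases
      case 1
      show ?thesis
      proof (cases "v \<in> verts X \<mu>")
        case True
        then obtain m where "m > 0" and m: "run \<mu> v (concat (replicate m c)) = v"
          using Q(2) by (auto simp: 1 Q1_def)
        obtain d where "\<forall>\<mu>'. agree d \<mu> \<mu>' \<longrightarrow> run \<mu>' v (concat (replicate m c)) = v"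
          using run_agree[of \<mu> v "concat (replicate m c)"] m by auto
        then show ?thesis
          using \<open>m > 0\<close> unfolding 1 Q1_def by blast
      next
        case False
        then show ?thesis
          using agree_verts[of "length v" \<mu> _ v X] unfolding 1 Q1_def by blast
      qed
    next
      case 2
      show ?thesis
      proof (cases "set zs \<subseteq> verts X \<mu>")
        case True
        then obtain u where u: "set u \<subseteq> X \<times> UNIV"
            "\<And>z. z \<in> set zs \<Longrightarrow> run \<mu> z u = (if z = x then y else if z = y then x else z)"
          using Q(2) unfolding 2 Q2_def by blast
        obtain d where "\<And>\<mu>' z. agree d \<mu> \<mu>' \<Longrightarrow> z \<in> set zs \<Longrightarrow> run \<mu>' z u = run \<mu> z u"
          using run_agree_finite[of "set zs \<times> {u}" \<mu>] by auto
        then show ?thesis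
          using u unfolding 2 Q2_def by metis
      next
        case False
        then obtain v where "v \<in> set zs" "v \<notin> verts X \<mu>"
          by blast
        then show ?thesis
          using agree_verts[of "length v" \<mu> _ v X] unfolding 2 Q2_def by blast
      qed
    qed
  qed
  moreover have "([[]], [], []) \<in> T2"
    by (simp add: T2_def)
  then have "\<Q> \<noteq> {}"
    by (auto simp: \<Q>_def)
  ultimately obtain \<mu> where \<mu>: "gluing X \<mu>" "\<And>Q. Q \<in> \<Q> \<Longrightarrow> Q \<mu>"
    using generic_gluing[of \<Q> X] by metis
  have verts: "v \<in> lists L" if "v \<in> verts X \<mu>" for v
    using that by (auto simp: verts_def reduced_words_eq L_def)
  have "\<exists>m>0. run \<mu> v (concat (replicate m c)) = v"
    if "v \<in> verts X \<mu>" "cyclically_reduced c" "set c \<subseteq> X \<times> UNIV" for v c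
  proof -
    have "(v, c) \<in> T1"
      using that verts by (auto simp: T1_def L_def)
    then have "Q1 v c \<mu>"
      using \<mu>(2)[of "Q1 v c"] unfolding \<Q>_def by force
    then show ?thesis
      using that(1) unfolding Q1_def by blast
  qed
  moreover have "\<exists>u. set u \<subseteq> X \<times> UNIV \<and> (\<forall>z\<in>Z. run \<mu> z u = (if z = x then y else if z = y then x else z))"
    if Z: "finite Z" "Z \<subseteq> verts X \<mu>" "x \<in> Z" "y \<in> Z" for Z x y
  proof -
    obtain zs where zs: "set zs = Z"
      using finite_list[OF Z(1)] by blast
    have "(zs, x, y) \<in> T2"
      using Z verts zs unfolding T2_def by (auto simp: in_lists_conv_set)
    then have "Q2 zs x y \<mu>"
      using \<mu>(2)[of "Q2 zs x y"] unfolding \<Q>_def by force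
    then show ?thesis
      using Z(2) unfolding Q2_def zs by blast
  qed
  ultimately show ?thesis
    using \<mu>(1) by blast
qed

section \<open>Counting words and vertices by level\<close>

lemma card_ball_le:
  assumes "finite X" "card X \<ge> 2"
  shows "card {w \<in> reduced_words X. length w \<le> n} \<le> 2 * (2 * card X - 1) ^ n"
proof -
  define q where "q = 2 * card X - 1"
  define W where "W n = {w \<in> reduced_words X. length w = n}" for n
  have q: "q \<ge> 3" "card (X \<times> (UNIV :: bool set)) = Suc q"
    using assms(2) by (simp_all add: q_def card_cartesian_product)
  have finW: "finite (W n)" for n
    unfolding W_def by (rule finite_reduced_words_length[OF assms(1)])
  have finL: "finite (X \<times> (UNIV :: bool set))"
    using assms(1) by simp
  have W_Suc: "card (W (Suc n)) \<le> (q + 1) * q ^ n" for n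
  proof (induction n)
    case 0
    have "W (Suc 0) \<subseteq> (\<lambda>l. [l]) ` (X \<times> UNIV)"
      by (auto simp: W_def reduced_words_eq length_Suc_conv)
    then have "card (W (Suc 0)) \<le> card (X \<times> (UNIV :: bool set))"
      by (rule surj_card_le[OF finL])
    then show ?case
      by (simp add: q)
  next
    case (Suc n)
    define E where "E = (SIGMA v:W (Suc n). X \<times> UNIV - {inv_letter (last v)})"
    have finE: "finite E"
      using finW finL by (simp add: E_def)
    have "W (Suc (Suc n)) \<subseteq> (\<lambda>(v, l). v @ [l]) ` E"
    proof
      fix w assume w: "w \<in> W (Suc (Suc n))"
      then obtain v l where vl: "w = v @ [l]"
        by (auto simp: W_def length_Suc_conv_rev)
      then have "(v, l) \<in> E"
        using w by (auto simp: W_def E_def reduced_words_eq reduced_snoc)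
      then show "w \<in> (\<lambda>(v, l). v @ [l]) ` E"
        using vl by force
    qed
    then have "card (W (Suc (Suc n))) \<le> card E"
      by (rule surj_card_le[OF finE])
    also have "card E = (\<Sum>v\<in>W (Suc n). card (X \<times> UNIV - {inv_letter (last v)}))"
      using finW finL by (simp add: E_def)
    also have "\<dots> = (\<Sum>v\<in>W (Suc n). q)"
    proof (rule sum.cong)
      fix v assume "v \<in> W (Suc n)"
      then have "v \<noteq> []" "set v \<subseteq> X \<times> UNIV"
        by (auto simp: W_def reduced_words_eq)
      then have "last v \<in> X \<times> UNIV"
        using last_in_set by blast
      then have "inv_letter (last v) \<in> X \<times> UNIV"
        by (simp del: mem_Times_iff)
      then show "card (X \<times> UNIV - {inv_letter (last v)}) = q"
        using finL by (simp add: q del: mem_Times_iff)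
    qed simp
    also have "\<dots> = card (W (Suc n)) * q"
      by simp
    also have "\<dots> \<le> (q + 1) * q ^ n * q"
      using Suc by (rule mult_right_mono) simp
    also have "\<dots> = (q + 1) * q ^ Suc n"
      by (simp add: algebra_simps)
    finally show ?case .
  qed
  \<comment> \<open>Adding the next sphere gives at most \<open>(q + 3) * q ^ n\<close>, and
    \<open>q + 3 \<le> 2 * q\<close> because \<open>q \<ge> 3\<close>.\<close>
  have "card {w \<in> reduced_words X. length w \<le> n} \<le> 2 * q ^ n"
  proof (induction n)
    case 0
    have "{w \<in> reduced_words X. length w \<le> 0} \<subseteq> {[]}"
      by auto
    from card_mono[OF _ this] show ?case
      by simp
  next
    case (Suc n)
    have "{w \<in> reduced_words X. length w \<le> Suc n} = {w \<in> reduced_words X. length w \<le> n} \<union> W (Suc n)"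
      by (auto simp: W_def)
    then have "card {w \<in> reduced_words X. length w \<le> Suc n} \<le> 2 * q ^ n + (q + 1) * q ^ n"
      using Suc W_Suc[of n] card_Un_le[of "{w \<in> reduced_words X. length w \<le> n}" "W (Suc n)"] by simp
    also have "\<dots> = (q + 3) * q ^ n"
      by (simp add: algebra_simps)
    also have "\<dots> \<le> (2 * q) * q ^ n"
      using q(1) by (intro mult_right_mono) auto
    finally show ?case
      by simp
  qed
  then show ?thesis
    by (simp add: q_def)
qed

text \<open>Each vertex has \<open>q\<close> continuations away from the root, and at most
  \<open>n\<close> of those reaching level \<open>Suc n\<close> are cut. The surplus
  \<open>Suc n\<close> in the claim pays for this: multiplied by \<open>q \<ge> 3\<close>, it covers
  the next loss and the next surplus.\<close>

lemma (in gluing) card_verts_length_ge: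
  assumes "finite X" "card X \<ge> 2"
  shows "(2 * card X - 1) ^ Suc n + Suc n \<le> card {v \<in> verts X \<mu>. length v = Suc n}"
proof -
  define q where "q = 2 * card X - 1"
  have q: "q \<ge> 3" "card (X \<times> (UNIV :: bool set)) = Suc q"
    using assms(2) by (simp_all add: q_def card_cartesian_product)
  define S where "S n = {v \<in> verts X \<mu>. length v = n}" for n
  define C where "C n = {w \<in> dom \<mu>. length w = n}" for n
  have finL: "finite (X \<times> (UNIV :: bool set))"
    using assms(1) by simp
  have fin: "finite (S n)" "finite (C n)" for n
    using glued_reduced
    by (auto simp: S_def C_def verts_def intro!: finite_subset[OF _ finite_reduced_words_length[OF assms(1), of n]])
  \<comment> \<open>The additional 1 is the extra continuation of the root. Level 1 has no cuts, so
    the induction starts with \<open>q + 1\<close> vertices.\<close>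
  have step: "q * card (S n) + (if n = 0 then 1 else 0) \<le> card (S (Suc n)) + n" for n
  proof -
    define E where "E = (SIGMA v:S n. {l \<in> X \<times> UNIV. v = [] \<or> l \<noteq> inv_letter (last v)})"
    have "(\<lambda>(v, l). v @ [l]) ` E \<subseteq> S (Suc n) \<union> C (Suc n)"
      by (auto simp: E_def S_def C_def verts_snoc verts_snoc[of "[]", simplified] dom_def)
    then have "card ((\<lambda>(v, l). v @ [l]) ` E) \<le> card (S (Suc n) \<union> C (Suc n))"
      by (intro card_mono) (simp_all add: fin)
    also have "\<dots> \<le> card (S (Suc n)) + n"
      using card_Un_le[of "S (Suc n)" "C (Suc n)"] glued_sparse[of n] by (simp add: C_def)
    also have "card ((\<lambda>(v, l). v @ [l]) ` E) = card E"
      by (intro card_image inj_onI) auto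
    also have "card E = (\<Sum>v\<in>S n. card {l \<in> X \<times> UNIV. v = [] \<or> l \<noteq> inv_letter (last v)})"
      unfolding E_def using fin finL by (intro card_SigmaI) (auto intro: finite_subset[of _ "X \<times> UNIV"])
    also have "\<dots> = (\<Sum>v\<in>S n. q + (if n = 0 then 1 else 0))"
    proof (rule sum.cong)
      fix v assume v: "v \<in> S n"
      show "card {l \<in> X \<times> UNIV. v = [] \<or> l \<noteq> inv_letter (last v)} = q + (if n = 0 then 1 else 0)"
      proof (cases "n = 0")
        case True
        then show ?thesis
          using v q(2) by (simp add: S_def)
      next
        case False
        then have "v \<noteq> []" "set v \<subseteq> X \<times> UNIV"
          using v by (auto simp: S_def verts_def reduced_words_eq)
        then have "last v \<in> X \<times> UNIV"
          using last_in_set by blast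
        then have "inv_letter (last v) \<in> X \<times> UNIV"
          by (simp del: mem_Times_iff)
        moreover have "{l \<in> X \<times> UNIV. v = [] \<or> l \<noteq> inv_letter (last v)} = X \<times> UNIV - {inv_letter (last v)}"
          using \<open>v \<noteq> []\<close> by auto
        ultimately show ?thesis
          using finL False by (simp add: q del: mem_Times_iff)
      qed
    qed simp
    finally have "(q + (if n = 0 then 1 else 0)) * card (S n) \<le> card (S (Suc n)) + n"
      by (simp add: mult.commute)
    moreover have "S 0 = {[]}"
      using Nil_verts by (auto simp: S_def)
    ultimately show ?thesis
      by (cases "n = 0") auto
  qed
  have "q ^ Suc n + Suc n \<le> card (S (Suc n))"
  proof (induction n)
    case 0
    have "S 0 = {[]}"
      using Nil_verts by (auto simp: S_def)
    then show ?case
      using step[of 0] by simp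
  next
    case (Suc n)
    have "q ^ Suc (Suc n) + q * Suc n \<le> q * card (S (Suc n))"
      using mult_le_mono2[OF Suc, of q] by (simp add: distrib_left)
    moreover have "3 * Suc n \<le> q * Suc n"
      using q(1) by (intro mult_right_mono) auto
    ultimately show ?case
      using step[of "Suc n"] by simp
  qed
  then show ?thesis
    by (simp add: q_def S_def)
qed

section \<open>Permutation modules\<close>

lemma poly_mapping_sum_single:
  assumes "finite A" "Poly_Mapping.keys x \<subseteq> A"
  shows "x = (\<Sum>i\<in>A. Poly_Mapping.single i (Poly_Mapping.lookup x i))"
proof (rule poly_mapping_eqI)
  fix j
  have "Poly_Mapping.lookup (\<Sum>i\<in>A. Poly_Mapping.single i (Poly_Mapping.lookup x i)) j =
      (\<Sum>i\<in>A. if i = j then Poly_Mapping.lookup x j else 0)"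
    unfolding lookup_sum by (intro sum.cong) (auto simp: lookup_single when_def)
  also have "\<dots> = Poly_Mapping.lookup x j"
    using assms by (auto simp: sum.delta in_keys_iff subset_iff)
  finally show "Poly_Mapping.lookup x j =
      Poly_Mapping.lookup (\<Sum>i\<in>A. Poly_Mapping.single i (Poly_Mapping.lookup x i)) j" ..
qed

lemma poly_mapping_induct_add [case_names single add]:
  fixes x :: "'i \<Rightarrow>\<^sub>0 'c::comm_monoid_add"
  assumes single: "\<And>i c. P (Poly_Mapping.single i c)" and add: "\<And>x y. P x \<Longrightarrow> P y \<Longrightarrow> P (x + y)"
  shows "P x"
proof -
  have "P (\<Sum>i\<in>A. Poly_Mapping.single i (Poly_Mapping.lookup x i))" if "finite A" for A
    using that
  proof induction
    case empty
    then show ?case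
      using single[of undefined 0] by simp
  qed (simp add: assms)
  from this[OF finite_keys] show ?thesis
    using poly_mapping_sum_single[OF finite_keys order.refl] by metis
qed

text \<open>The augmentation. On the group algebra it is the character behind
  \<open>trivial_act\<close>; on the permutation module its kernel is the submodule \<open>N\<close>
  of the theorem.\<close>

definition aug :: "('i \<Rightarrow>\<^sub>0 'c::comm_monoid_add) \<Rightarrow> 'c" where
  "aug x = (\<Sum>i\<in>Poly_Mapping.keys x. Poly_Mapping.lookup x i)"

lemma aug_superset:
  assumes "finite A" "Poly_Mapping.keys x \<subseteq> A" shows "aug x = (\<Sum>i\<in>A. Poly_Mapping.lookup x i)"
  unfolding aug_def using assms by (intro sum.mono_neutral_left) (auto simp: in_keys_iff)

lemma aug_single [simp]: "aug (Poly_Mapping.single i c) = c"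
  by (simp add: aug_def)

lemma aug_add [simp]: "aug (x + y) = aug x + aug y"
proof -
  let ?A = "Poly_Mapping.keys x \<union> Poly_Mapping.keys y"
  have "aug (x + y) = (\<Sum>i\<in>?A. Poly_Mapping.lookup (x + y) i)"
    using keys_add[of x y] by (intro aug_superset) auto
  also have "\<dots> = aug x + aug y"
    by (simp add: lookup_add sum.distrib aug_superset[of ?A])
  finally show ?thesis .
qed

lemma aug_0 [simp]: "aug 0 = 0"
  by (simp add: aug_def)

lemma aug_minus [simp]: "aug (- x) = - aug (x :: 'i \<Rightarrow>\<^sub>0 'c::ab_group_add)"
  using aug_add[of x "- x"] by (simp add: eq_neg_iff_add_eq_0 add.commute)

lemma aug_diff [simp]: "aug (x - y) = aug x - aug (y :: 'i \<Rightarrow>\<^sub>0 'c::ab_group_add)"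
  using aug_add[of x "- y"] by simp

context right_module
begin

lemma act_zero_left [simp]: "act 0 p = 0"
  using act_add_left[of 0 0 p] by simp

lemma act_zero_right [simp]: "act x 0 = 0"
  using act_add_right[of x 0 0] by simp

lemma act_minus_left: "act (- x) p = - act x p"
  using act_add_left[of x "- x" p] by (simp add: eq_neg_iff_add_eq_0 add.commute)

lemma act_minus_right: "act x (- p) = - act x p"
  using act_add_right[of x p "- p"] by (simp add: eq_neg_iff_add_eq_0 add.commute)

lemma act_diff_left: "act (x - y) p = act x p - act y p"
  using act_add_left[of x "- y" p] by (simp add: act_minus_left)

end

text \<open>Negatives are obtained by acting with \<open>- 1\<close>.\<close>

lemma submodule_diff:
  assumes "right_module act" "submodule act W" "x \<in> W" "y \<in> W"
  shows "x - y \<in> W"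
proof -
  interpret right_module act by fact
  have "act y (- 1) = - y"
    by (simp add: act_minus_right act_one)
  then have "- y \<in> W"
    using assms(2,4) unfolding submodule_def by metis
  then have "x + - y \<in> W"
    using assms(2,3) unfolding submodule_def by blast
  then show ?thesis
    by simp
qed

lemma submodule_sum:
  assumes "submodule act W" "\<And>i. i \<in> A \<Longrightarrow> f i \<in> W" shows "sum f A \<in> W"
  using assms(2) by (induction A rule: infinite_finite_induct) (use assms(1) in \<open>auto simp: submodule_def\<close>)

lemma right_module_mult: "right_module (*)"
  by standard (simp_all add: algebra_simps)

lemma vector_space_scalar:
  fixes act :: "'m::ab_group_add \<Rightarrow> ('g::group_add \<Rightarrow>\<^sub>0 'k::field) \<Rightarrow> 'm"
  assumes "right_module act" shows "vector_space (scalar act)"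
proof -
  interpret right_module act by fact
  show ?thesis
  proof
    fix a b :: 'k and x y :: 'm
    show "scalar act a (x + y) = scalar act a x + scalar act a y"
      by (simp add: scalar_def act_add_left)
    show "scalar act (a + b) x = scalar act a x + scalar act b x"
      by (simp add: scalar_def single_add act_add_right)
    show "scalar act a (scalar act b x) = scalar act (a * b) x"
      by (simp add: scalar_def mult_single mult.commute flip: act_mult)
    show "scalar act 1 x = x"
      by (simp add: scalar_def act_one)
  qed
qed

lemma grp_elt_power: "(grp_elt g :: 'g::group_add \<Rightarrow>\<^sub>0 'k::field) ^ m = grp_elt (sum_list (replicate m g))"
  by (induction m) (simp_all add: mult_single)

text \<open>The bilinear extension of a right action \<open>pt\<close> on points to the group
  algebra.\<close>

definition perm_act :: "('p \<Rightarrow> 'g \<Rightarrow> 'p) \<Rightarrow> ('p \<Rightarrow>\<^sub>0 'k) \<Rightarrow> ('g::group_add \<Rightarrow>\<^sub>0 'k::field) \<Rightarrow> ('p \<Rightarrow>\<^sub>0 'k)" where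
  "perm_act pt x p = (\<Sum>i\<in>Poly_Mapping.keys x. \<Sum>g\<in>Poly_Mapping.keys p.
     Poly_Mapping.single (pt i g) (Poly_Mapping.lookup x i * Poly_Mapping.lookup p g))"

text \<open>Index sets larger than the supports allow several vectors to be compared over common
  sums.\<close>

lemma perm_act_superset:
  assumes "finite A" "Poly_Mapping.keys x \<subseteq> A" "finite B" "Poly_Mapping.keys p \<subseteq> B"
  shows "perm_act pt x p =
    (\<Sum>i\<in>A. \<Sum>g\<in>B. Poly_Mapping.single (pt i g) (Poly_Mapping.lookup x i * Poly_Mapping.lookup p g))"
proof -
  have "perm_act pt x p = (\<Sum>i\<in>Poly_Mapping.keys x. \<Sum>g\<in>B.
      Poly_Mapping.single (pt i g) (Poly_Mapping.lookup x i * Poly_Mapping.lookup p g))"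
    unfolding perm_act_def using assms(3,4)
    by (intro sum.cong sum.mono_neutral_left) (auto simp: in_keys_iff)
  also have "\<dots> = (\<Sum>i\<in>A. \<Sum>g\<in>B.
      Poly_Mapping.single (pt i g) (Poly_Mapping.lookup x i * Poly_Mapping.lookup p g))"
    using assms(1,2) by (intro sum.mono_neutral_left) (auto simp: in_keys_iff)
  finally show ?thesis .
qed

lemma perm_act_single [simp]:
  "perm_act pt (Poly_Mapping.single i c) (Poly_Mapping.single g d) = Poly_Mapping.single (pt i g) (c * d)"
  by (subst perm_act_superset[of "{i}" _ "{g}"]) (auto simp: keys_single)

lemma perm_act_add_left: "perm_act pt (x + y) p = perm_act pt x p + perm_act pt y p"
proof -
  let ?A = "Poly_Mapping.keys x \<union> Poly_Mapping.keys y" and ?B = "Poly_Mapping.keys p"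
  have "Poly_Mapping.keys (x + y) \<subseteq> ?A"
    by (rule keys_add)
  then show ?thesis
    by (simp add: perm_act_superset[of ?A _ ?B] lookup_add distrib_right single_add sum.distrib)
qed

lemma perm_act_add_right: "perm_act pt x (p + q) = perm_act pt x p + perm_act pt x q"
proof -
  let ?A = "Poly_Mapping.keys x" and ?B = "Poly_Mapping.keys p \<union> Poly_Mapping.keys q"
  have "Poly_Mapping.keys (p + q) \<subseteq> ?B"
    by (rule keys_add)
  then show ?thesis
    by (simp add: perm_act_superset[of ?A _ ?B] lookup_add distrib_left single_add sum.distrib)
qed

locale perm_module =
  fixes pt :: "'p \<Rightarrow> 'g::group_add \<Rightarrow> 'p"
  assumes pt_zero [simp]: "pt i 0 = i" and pt_add: "pt i (g + h) = pt (pt i g) h"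
begin

lemma pt_minus [simp]: "pt (pt i g) (- g) = i" "pt (pt i (- g)) g = i"
  by (simp_all flip: pt_add)

sublocale right_module "perm_act pt :: ('p \<Rightarrow>\<^sub>0 'k) \<Rightarrow> ('g \<Rightarrow>\<^sub>0 'k::field) \<Rightarrow> ('p \<Rightarrow>\<^sub>0 'k)"
proof
  fix x y :: "'p \<Rightarrow>\<^sub>0 'k" and p q :: "'g \<Rightarrow>\<^sub>0 'k"
  show "perm_act pt (x + y) p = perm_act pt x p + perm_act pt y p"
    by (rule perm_act_add_left)
  show "perm_act pt x (p + q) = perm_act pt x p + perm_act pt x q"
    by (rule perm_act_add_right)
  show "perm_act pt x (p * q) = perm_act pt (perm_act pt x p) q"
  proof (induction x rule: poly_mapping_induct_add)
    case x: (single i c)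
    show ?case
    proof (induction p rule: poly_mapping_induct_add)
      case p: (single g d)
      show ?case
      proof (induction q rule: poly_mapping_induct_add)
        case (single h e)
        show ?case
          by (simp add: mult_single pt_add mult.assoc)
      qed (simp add: perm_act_add_right distrib_left)
    qed (simp add: perm_act_add_left perm_act_add_right distrib_right)
  qed (simp add: perm_act_add_left)
  show "perm_act pt x 1 = x"
  proof (induction x rule: poly_mapping_induct_add)
    case (single i c)
    show ?case
      by (simp flip: single_one)
  qed (simp add: perm_act_add_left)
qed

lemma lookup_scalar: "Poly_Mapping.lookup (scalar (perm_act pt) c x) i = c * Poly_Mapping.lookup x i"
proof (induction x rule: poly_mapping_induct_add)
  case (single j d)
  show ?case
    by (simp add: scalar_def lookup_single when_def mult.commute)
qed (simp add: scalar_def perm_act_add_left lookup_add distrib_left)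

lemma aug_perm_act [simp]: "aug (perm_act pt x p) = aug x * aug p"
proof (induction x rule: poly_mapping_induct_add)
  case x: (single i c)
  show ?case
  proof (induction p rule: poly_mapping_induct_add)
    case (single g d)
    show ?case
      by simp
  qed (simp add: perm_act_add_right distrib_left)
qed (simp add: perm_act_add_left distrib_right)

lemma perm_act_fixed:
  assumes "\<And>i. i \<in> Poly_Mapping.keys x \<Longrightarrow> pt i g = i"
  shows "perm_act pt x (grp_elt g) = x"
proof -
  have "perm_act pt x (grp_elt g) = (\<Sum>i\<in>Poly_Mapping.keys x. Poly_Mapping.single i (Poly_Mapping.lookup x i))"
    by (subst perm_act_superset[of "Poly_Mapping.keys x" _ "{g}"]) (auto simp: assms keys_single)
  then show ?thesis
    using poly_mapping_sum_single[of "Poly_Mapping.keys x" x] by simp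
qed

text \<open>A vector has finite support, and the product of the periods of its points is a common
  period.\<close>

lemma periodic_perm_act:
  assumes "\<And>i g. \<exists>m>0. pt i (sum_list (replicate m g)) = i"
  shows "periodic (perm_act pt) N"
  unfolding periodic_def
proof (intro ballI allI)
  fix x :: "'p \<Rightarrow>\<^sub>0 'k::field" and g
  have multiple: "pt i (sum_list (replicate (k * m) g)) = i" if "pt i (sum_list (replicate m g)) = i" for i k m
    by (induction k) (simp_all add: replicate_add pt_add that)
  have "\<exists>m>0. \<forall>i\<in>A. pt i (sum_list (replicate m g)) = i" if "finite A" for A
    using that
  proof induction
    case (insert i A)
    then obtain m where m: "m > 0" "\<And>i. i \<in> A \<Longrightarrow> pt i (sum_list (replicate m g)) = i"
      by blast
    obtain k where k: "k > 0" "pt i (sum_list (replicate k g)) = i"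
      using assms by blast
    have "\<forall>j\<in>insert i A. pt j (sum_list (replicate (k * m) g)) = j"
      using multiple[OF m(2)] multiple[OF k(2), of m] by (auto simp: mult.commute)
    then show ?case
      using m(1) k(1) by (intro exI[of _ "k * m"]) simp
  qed auto
  from this[OF finite_keys] obtain m where "m > 0"
      "\<And>i. i \<in> Poly_Mapping.keys x \<Longrightarrow> pt i (sum_list (replicate m g)) = i"
    by blast
  then show "\<exists>m>0. perm_act pt x (grp_elt g ^ m) = x"
    using perm_act_fixed[of x] by (auto simp: grp_elt_power)
qed

lemma submodule_aug: "submodule (perm_act pt) {x. aug x = 0}"
  by (simp add: submodule_def)

lemma has_codim_aug: "has_codim (perm_act pt :: ('p \<Rightarrow>\<^sub>0 'k::field) \<Rightarrow> _) {x. aug x = 0} 1"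
  unfolding has_codim_def
proof (intro exI conjI allI)
  \<comment> \<open>Any point has augmentation 1 and so spans the quotient; the coefficient is
    forced to be \<open>aug x\<close>.\<close>
  let ?b = "grp_elt undefined :: 'p \<Rightarrow>\<^sub>0 'k"
  show "finite {?b}" "card {?b} = 1"
    by simp_all
  fix x :: "'p \<Rightarrow>\<^sub>0 'k"
  show "\<exists>!c. (\<forall>b. b \<notin> {?b} \<longrightarrow> c b = 0) \<and>
      x - (\<Sum>b\<in>{?b}. scalar (perm_act pt) (c b) b) \<in> {x. aug x = 0}"
    by (rule ex1I[of _ "\<lambda>b. if b = ?b then aug x else 0"]) (auto simp: scalar_def fun_eq_iff)
qed

text \<open>Transposing a support point \<open>x\<close> of \<open>v\<close> with a point
  \<open>y\<close> outside the support changes \<open>v\<close> by a multiple of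
  \<open>y - x\<close>. Further transpositions move \<open>y\<close> to any other point with
  \<open>x\<close> fixed, and the differences \<open>z - x\<close> span the kernel of
  \<open>aug\<close>.\<close>

lemma simple_aug:
  assumes infinite: "infinite (UNIV :: 'p set)"
    and swap: "\<And>Z x y. finite Z \<Longrightarrow> x \<in> Z \<Longrightarrow> y \<in> Z \<Longrightarrow>
      \<exists>g. \<forall>z\<in>Z. pt z g = (if z = x then y else if z = y then x else z)"
  shows "simple_submodule (perm_act pt :: ('p \<Rightarrow>\<^sub>0 'k::field) \<Rightarrow> _) {x. aug x = 0}"
  unfolding simple_submodule_def
proof (intro conjI allI impI submodule_aug)
  obtain i j :: 'p where "i \<noteq> j"
    using ex_new_if_finite[OF infinite, of "{undefined}"] by auto
  then have "Poly_Mapping.lookup (grp_elt i - grp_elt j :: 'p \<Rightarrow>\<^sub>0 'k) i \<noteq> 0"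
    by (simp add: lookup_minus lookup_single)
  then have "grp_elt i - grp_elt j \<noteq> (0 :: 'p \<Rightarrow>\<^sub>0 'k)"
    by force
  moreover have "aug (grp_elt i - grp_elt j :: 'p \<Rightarrow>\<^sub>0 'k) = 0"
    by simp
  ultimately show "{x :: 'p \<Rightarrow>\<^sub>0 'k. aug x = 0} \<noteq> {0}"
    by blast
next
  fix W :: "('p \<Rightarrow>\<^sub>0 'k) set" assume W: "submodule (perm_act pt) W \<and> W \<subseteq> {x. aug x = 0}"
  show "W = {0} \<or> W = {x. aug x = 0}"
  proof (cases "W = {0}")
    case False
    have act_W: "perm_act pt x p \<in> W" if "x \<in> W" for x p
      using W that by (simp add: submodule_def)
    have diff_W: "x - y \<in> W" if "x \<in> W" "y \<in> W" for x y
      using submodule_diff[OF right_module_axioms] W that by blast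
    have "0 \<in> W"
      using W by (simp add: submodule_def)
    then obtain v where "v \<in> W" "v \<noteq> 0"
      using False by blast
    then obtain x where x: "x \<in> Poly_Mapping.keys v"
      by (metis equals0I keys_eq_empty)
    define c where "c = Poly_Mapping.lookup v x"
    have "c \<noteq> 0"
      using x by (simp add: c_def in_keys_iff)
    obtain y where y: "y \<notin> Poly_Mapping.keys v"
      using ex_new_if_finite[OF infinite finite_keys] by blast
    have "x \<noteq> y"
      using x y by auto
    obtain g where g: "\<forall>z\<in>insert y (Poly_Mapping.keys v). pt z g = (if z = x then y else if z = y then x else z)"
      using swap[of "insert y (Poly_Mapping.keys v)" x y] x by auto
    \<comment> \<open>Neither \<open>x\<close> nor \<open>y\<close> lies in the support of
      \<open>v'\<close>, so \<open>g\<close> fixes \<open>v'\<close>.\<close>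
    define v' where "v' = v - Poly_Mapping.single x c"
    have "i \<in> Poly_Mapping.keys v \<and> i \<noteq> x" if "i \<in> Poly_Mapping.keys v'" for i
      using that by (auto simp: v'_def c_def in_keys_iff lookup_minus lookup_single when_def split: if_splits)
    then have "perm_act pt v' (grp_elt g) = v'"
      using g y by (intro perm_act_fixed) auto
    moreover have "v = v' + Poly_Mapping.single x c"
      by (simp add: v'_def)
    ultimately have "perm_act pt v (grp_elt g) = v' + Poly_Mapping.single y c"
      using g x by (simp add: perm_act_add_left)
    then have "perm_act pt v (grp_elt g) - v = Poly_Mapping.single y c - Poly_Mapping.single x c"
      using \<open>v = v' + Poly_Mapping.single x c\<close> by (simp add: algebra_simps)
    then have "Poly_Mapping.single y c - Poly_Mapping.single x c \<in> W"
      using act_W diff_W \<open>v \<in> W\<close> by metis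
    then have "perm_act pt (Poly_Mapping.single y c - Poly_Mapping.single x c) (Poly_Mapping.single 0 (1 / c)) \<in> W"
      by (rule act_W)
    then have yx: "grp_elt y - grp_elt x \<in> W"
      using \<open>c \<noteq> 0\<close> by (simp add: act_diff_left)
    have zx: "grp_elt z - grp_elt x \<in> W" for z
    proof (cases "z = x \<or> z = y")
      case False
      then obtain h where "\<forall>w\<in>{x, y, z}. pt w h = (if w = y then z else if w = z then y else w)"
        using swap[of "{x, y, z}" y z] by auto
      then have "perm_act pt (grp_elt y - grp_elt x) (grp_elt h) = (grp_elt z - grp_elt x :: 'p \<Rightarrow>\<^sub>0 'k)"
        using False \<open>x \<noteq> y\<close> by (auto simp: act_diff_left)
      then show ?thesis
        using act_W[OF yx] by metis
    qed (use yx \<open>0 \<in> W\<close> in auto)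
    have "u \<in> W" if "aug u = 0" for u
    proof -
      \<comment> \<open>The combination of the differences with the coefficients of \<open>u\<close>
        is \<open>u\<close> minus \<open>aug u\<close> times \<open>x\<close>, that is,
        \<open>u\<close> itself.\<close>
      have "(\<Sum>i\<in>Poly_Mapping.keys u. perm_act pt (grp_elt i - grp_elt x) (Poly_Mapping.single 0 (Poly_Mapping.lookup u i))) \<in> W"
        using W act_W zx by (intro submodule_sum) auto
      also have "(\<Sum>i\<in>Poly_Mapping.keys u. perm_act pt (grp_elt i - grp_elt x) (Poly_Mapping.single 0 (Poly_Mapping.lookup u i))) =
          (\<Sum>i\<in>Poly_Mapping.keys u. Poly_Mapping.single i (Poly_Mapping.lookup u i)) -
          (\<Sum>i\<in>Poly_Mapping.keys u. Poly_Mapping.single x (Poly_Mapping.lookup u i))"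
        by (simp add: act_diff_left sum_subtractf)
      also have "(\<Sum>i\<in>Poly_Mapping.keys u. Poly_Mapping.single x (Poly_Mapping.lookup u i)) = Poly_Mapping.single x (aug u)"
        unfolding aug_def by (rule sum_comp_morphism[unfolded o_def, of "Poly_Mapping.single x"]) (simp_all add: single_add)
      also have "(\<Sum>i\<in>Poly_Mapping.keys u. Poly_Mapping.single i (Poly_Mapping.lookup u i)) = u"
        using poly_mapping_sum_single[of "Poly_Mapping.keys u" u] by simp
      finally show ?thesis
        using that by simp
    qed
    then show ?thesis
      using W by blast
  qed simp
qed

end

section \<open>Monomial modules\<close>

lemma group_closure_sum: "(\<And>i. i \<in> A \<Longrightarrow> f i \<in> group_closure S) \<Longrightarrow> sum f A \<in> group_closure S"
  by (induction A rule: infinite_finite_induct) (auto intro: group_closure_add)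

context perm_module
begin

text \<open>On a fixed point the subgroup algebra acts through the augmentation, exactly as on the
  trivial module. This makes the relators that move \<open>s\<close> across the tensor sign vanish
  under \<psi> below.\<close>

lemma perm_act_stabilizer:
  assumes "\<And>g. g \<in> Poly_Mapping.keys s \<Longrightarrow> pt i g = i"
  shows "perm_act pt (Poly_Mapping.single i l) s = Poly_Mapping.single i (l * aug s)"
proof -
  have "perm_act pt (Poly_Mapping.single i l) s =
      (\<Sum>g\<in>Poly_Mapping.keys s. Poly_Mapping.single i (l * Poly_Mapping.lookup s g))"
    by (subst perm_act_superset[of "{i}" _ "Poly_Mapping.keys s"]) (auto simp: assms keys_single)
  also have "\<dots> = Poly_Mapping.single i (l * aug s)"
    unfolding aug_def sum_distrib_left
    by (rule sum_comp_morphism[unfolded o_def, of "Poly_Mapping.single i"]) (simp_all add: single_add)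
  finally show ?thesis .
qed

text \<open>With \<open>K\<close> the stabilizer of \<open>x0\<close>, \<psi> sends the formal
  tensor of \<open>l\<close> and \<open>b\<close> to \<open>l\<close> times \<open>x0\<close>, acted
  on by \<open>b\<close>. In the other direction \<sigma> writes a vector with coset representatives
  \<open>t i\<close>. Every \<open>z\<close> is congruent to \<open>\<sigma> (\<psi> z)\<close>, so
  the tensor classes are the fibres of \<psi>.\<close>

lemma monomial_perm_act:
  fixes x0 :: 'p
  assumes transitive: "\<And>i. \<exists>g. pt x0 g = i"
  shows "monomial_module (perm_act pt :: ('p \<Rightarrow>\<^sub>0 'k::field) \<Rightarrow> _)"
proof -
  define K where "K = {g. pt x0 g = x0}"
  have K: "is_subgroup K"
    unfolding is_subgroup_def K_def by (auto simp: pt_add) (metis pt_minus(1))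
  define S :: "('g \<Rightarrow>\<^sub>0 'k) set" where "S = subgroup_algebra K"
  define L :: "'k \<Rightarrow> ('g \<Rightarrow>\<^sub>0 'k) \<Rightarrow> 'k" where "L = trivial_act"
  have L: "L l s = l * aug s" for l s
    by (simp add: L_def trivial_act_def aug_def)
  define G where "G = group_closure (tensor_relators L S)"
  have G_add: "y + z \<in> G" if "y \<in> G" "z \<in> G" for y z
    using that unfolding G_def by (rule group_closure_add)
  have G_diff: "y - z \<in> G" if "y \<in> G" "z \<in> G" for y z
    using that unfolding G_def by (rule group_closure.diff)
  have G_zero: "0 \<in> G"
    by (simp add: G_def)
  have G_trans: "x - z \<in> G" if "x - y \<in> G" "y - z \<in> G" for x y z
    using G_add[OF that] by simp
  have rel: "frag_of (l + l', b) - frag_of (l, b) - frag_of (l', b) \<in> G"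
      "frag_of (l, b + b') - frag_of (l, b) - frag_of (l, b') \<in> G"
      "s \<in> S \<Longrightarrow> frag_of (L l s, b) - frag_of (l, s * b) \<in> G" for l l' b b' s
    unfolding G_def tensor_relators_def by (rule group_closure.base, blast)+

  define \<psi> :: "('k \<times> ('g \<Rightarrow>\<^sub>0 'k) \<Rightarrow>\<^sub>0 int) \<Rightarrow> ('p \<Rightarrow>\<^sub>0 'k)" where
    "\<psi> z = (\<Sum>u\<in>Poly_Mapping.keys z.
        perm_act pt (Poly_Mapping.single x0 (of_int (Poly_Mapping.lookup z u) * fst u)) (snd u))" for z
  have \<psi>_superset: "\<psi> z = (\<Sum>u\<in>A.
        perm_act pt (Poly_Mapping.single x0 (of_int (Poly_Mapping.lookup z u) * fst u)) (snd u))"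
    if "finite A" "Poly_Mapping.keys z \<subseteq> A" for z A
    unfolding \<psi>_def using that by (intro sum.mono_neutral_left) (auto simp: in_keys_iff)
  have \<psi>_diff: "\<psi> (y - z) = \<psi> y - \<psi> z" for y z
  proof -
    let ?A = "Poly_Mapping.keys y \<union> Poly_Mapping.keys z"
    have "Poly_Mapping.keys (y - z) \<subseteq> ?A"
      by (rule keys_diff)
    then show ?thesis
      by (simp add: \<psi>_superset[of ?A] lookup_minus left_diff_distrib single_diff act_diff_left sum_subtractf)
  qed
  have \<psi>_0: "\<psi> 0 = 0"
    by (simp add: \<psi>_def)
  have \<psi>_add: "\<psi> (y + z) = \<psi> y + \<psi> z" for y z
    using \<psi>_diff[of "y + z" z] by simp
  have \<psi>_of: "\<psi> (frag_of (l, b)) = perm_act pt (Poly_Mapping.single x0 l) b" for l b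
    by (subst \<psi>_superset[of "{(l, b)}"]) (auto simp: keys_single)
  have \<psi>_sum: "\<psi> (sum f A) = (\<Sum>i\<in>A. \<psi> (f i))" for f and A :: "'p set"
    by (induction A rule: infinite_finite_induct) (simp_all add: \<psi>_0 \<psi>_add)
  have \<psi>_rel: "\<psi> z = 0" if "z \<in> tensor_relators L S" for z
    using that unfolding tensor_relators_def
    by (auto simp: \<psi>_diff \<psi>_of single_add act_add_left act_add_right act_mult L
        S_def subgroup_algebra_def K_def perm_act_stabilizer subset_iff)
  have \<psi>_G: "\<psi> z = 0" if "z \<in> G" for z
    using that unfolding G_def
    by (induction rule: group_closure.induct) (auto simp: \<psi>_0 \<psi>_diff \<psi>_rel)

  obtain t where t: "\<And>i. pt x0 (t i) = i"
    using transitive by metis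
  define \<sigma> :: "('p \<Rightarrow>\<^sub>0 'k) \<Rightarrow> ('k \<times> ('g \<Rightarrow>\<^sub>0 'k) \<Rightarrow>\<^sub>0 int)" where
    "\<sigma> x = (\<Sum>i\<in>Poly_Mapping.keys x. frag_of (Poly_Mapping.lookup x i, grp_elt (t i)))" for x
  have \<psi>_\<sigma>: "\<psi> (\<sigma> x) = x" for x
    using poly_mapping_sum_single[of "Poly_Mapping.keys x" x] by (simp add: \<sigma>_def \<psi>_sum \<psi>_of t)
  have G_0: "frag_of (0, b) \<in> G" for b
  proof -
    have "0 - (frag_of (0 + 0, b) - frag_of (0, b) - frag_of (0, b)) \<in> G"
      by (rule G_diff[OF G_zero rel(1)])
    then show ?thesis
      by simp
  qed
  have \<sigma>_superset: "(\<Sum>i\<in>A. frag_of (Poly_Mapping.lookup x i, grp_elt (t i))) - \<sigma> x \<in> G"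
    if "finite A" "Poly_Mapping.keys x \<subseteq> A" for x A
  proof -
    have "(\<Sum>i\<in>A. frag_of (Poly_Mapping.lookup x i, grp_elt (t i) :: 'g \<Rightarrow>\<^sub>0 'k)) - \<sigma> x =
        (\<Sum>i\<in>A - Poly_Mapping.keys x. frag_of (Poly_Mapping.lookup x i, grp_elt (t i)))"
      using that by (simp add: \<sigma>_def sum_diff)
    also have "\<dots> = (\<Sum>i\<in>A - Poly_Mapping.keys x. frag_of (0, grp_elt (t i)))"
      by (intro sum.cong) (auto simp: in_keys_iff)
    also have "\<dots> \<in> G"
      using G_0 unfolding G_def by (intro group_closure_sum)
    finally show ?thesis .
  qed
  \<comment> \<open>Additivity holds only modulo the relators, since coefficients are added inside
    the pairs and the support may shrink.\<close>
  have \<sigma>_add: "\<sigma> (x + y) - (\<sigma> x + \<sigma> y) \<in> G" for x y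
  proof -
    let ?A = "Poly_Mapping.keys x \<union> Poly_Mapping.keys y"
    let ?s = "\<lambda>x. \<Sum>i\<in>?A. frag_of (Poly_Mapping.lookup x i, grp_elt (t i) :: 'g \<Rightarrow>\<^sub>0 'k)"
    have "?s (x + y) - ?s x - ?s y \<in> G"
      unfolding sum_subtractf[symmetric] lookup_add using rel(1) unfolding G_def
      by (intro group_closure_sum)
    moreover have s: "?s (x + y) - \<sigma> (x + y) \<in> G" "?s x - \<sigma> x \<in> G" "?s y - \<sigma> y \<in> G"
      using keys_add[of x y] by (auto intro!: \<sigma>_superset)
    from G_diff[OF G_add[OF G_add[OF calculation s(2)] s(3)] s(1)] have "(?s (x + y) - ?s x - ?s y) + (?s x - \<sigma> x) + (?s y - \<sigma> y) - (?s (x + y) - \<sigma> (x + y)) \<in> G"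
      .
    then show ?thesis
      by (simp add: algebra_simps)
  qed
  have \<sigma>_single: "frag_of (c, grp_elt (t i)) - \<sigma> (Poly_Mapping.single i c) \<in> G" for i c
    using \<sigma>_superset[of "{i}" "Poly_Mapping.single i c"] by (simp add: keys_single)
  have normal_of: "\<exists>x. frag_of (l, b) - \<sigma> x \<in> G" for l b
  proof (induction b rule: poly_mapping_induct_add)
    case (single g d)
    \<comment> \<open>Both \<open>g\<close> and \<open>t i\<close> take \<open>x0\<close> to
      \<open>i\<close>, so they differ by the element \<open>g - t i\<close> of \<open>K\<close>,
      which passes through the tensor sign.\<close>
    define i where "i = pt x0 g"
    have "pt x0 (g - t i) = x0"
      by (metis diff_conv_add_uminus i_def pt_add pt_minus(1) t)
    then have "Poly_Mapping.single (g - t i) d \<in> S"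
      by (auto simp: S_def subgroup_algebra_def K_def keys_single)
    from G_diff[OF G_zero rel(3)[OF this, of l "grp_elt (t i)"]] have "frag_of (l, Poly_Mapping.single g d) - frag_of (l * d, grp_elt (t i)) \<in> G"
      by (simp add: L mult_single)
    then show ?case
      using G_trans \<sigma>_single by blast
  next
    case (add b b')
    then obtain x x' where x: "frag_of (l, b) - \<sigma> x \<in> G" "frag_of (l, b') - \<sigma> x' \<in> G"
      by blast
    have "(frag_of (l, b + b') - frag_of (l, b) - frag_of (l, b')) + (frag_of (l, b) - \<sigma> x) +
        (frag_of (l, b') - \<sigma> x') - (\<sigma> (x + x') - (\<sigma> x + \<sigma> x')) \<in> G"
      by (rule G_diff[OF G_add[OF G_add[OF rel(2) x(1)] x(2)] \<sigma>_add])
    then have "frag_of (l, b + b') - \<sigma> (x + x') \<in> G"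
      by (simp add: algebra_simps)
    then show ?case
      by blast
  qed
  have "\<exists>x. z - \<sigma> x \<in> G" for z
    using subset_UNIV
  proof (induction z rule: frag_induction)
    case zero
    show ?case
      by (rule exI[of _ 0]) (simp add: \<sigma>_def G_def)
  next
    case (one u)
    then show ?case
      using normal_of[of "fst u" "snd u"] by simp
  next
    case (diff y z)
    then obtain x x' where x: "y - \<sigma> x \<in> G" "z - \<sigma> x' \<in> G"
      by blast
    have "(y - \<sigma> x) - (z - \<sigma> x') + (\<sigma> ((x - x') + x') - (\<sigma> (x - x') + \<sigma> x')) \<in> G"
      by (rule G_add[OF G_diff[OF x] \<sigma>_add])
    then have "(y - z) - \<sigma> (x - x') \<in> G"
      by (simp add: algebra_simps)
    then show ?case
      by blast
  qed
  \<comment> \<open>Since \<psi> recovers \<open>x\<close> from \<open>\<sigma> x\<close>, the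
    \<open>x\<close> just found can only be \<open>\<psi> z\<close>.\<close>
  moreover have "\<psi> z = x" if "z - \<sigma> x \<in> G" for z x
    using \<psi>_G[OF that] by (simp add: \<psi>_diff \<psi>_\<sigma>)
  ultimately have normal: "z - \<sigma> (\<psi> z) \<in> G" for z
    by metis

  have cong_iff: "(z, z') \<in> tensor_cong L S \<longleftrightarrow> \<psi> z = \<psi> z'" for z z'
  proof
    assume "(z, z') \<in> tensor_cong L S"
    then have "\<psi> (z - z') = 0"
      using \<psi>_G by (simp add: tensor_cong_def G_def)
    then show "\<psi> z = \<psi> z'"
      by (simp add: \<psi>_diff)
  next
    assume "\<psi> z = \<psi> z'"
    then have "(z - \<sigma> (\<psi> z)) - (z' - \<sigma> (\<psi> z)) \<in> G"
      using G_diff[OF normal[of z] normal[of z']] by simp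
    then show "(z, z') \<in> tensor_cong L S"
      by (simp add: tensor_cong_def G_def)
  qed
  define f where "f x = {z. \<psi> z = x}" for x
  have cls: "tensor_cong L S `` {z} = f (\<psi> z)" for z
    by (auto simp: f_def cong_iff)
  have f_mem: "\<sigma> x \<in> f x" for x
    by (simp add: f_def \<psi>_\<sigma>)
  have "inj f"
    by (rule injI) (use f_mem in \<open>force simp: f_def\<close>)
  moreover have "range f = tensor_carrier L S"
    unfolding tensor_carrier_def quotient_def cls using \<psi>_\<sigma> by (auto intro: range_eqI) (metis rangeI)
  ultimately have "bij_betw f UNIV (tensor_carrier L S)"
    by (simp add: bij_betw_def)
  moreover have "f (x + y) = tensor_add L S (f x) (f y)" for x y
  proof -
    \<comment> \<open>The union is constant, and the fibres over which it runs are nonempty by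
      \<open>f_mem\<close>.\<close>
    have "tensor_add L S (f x) (f y) = (\<Union>z\<in>f x. \<Union>w\<in>f y. f (x + y))"
      unfolding tensor_add_def cls by (intro SUP_cong refl) (simp add: f_def \<psi>_add)
    then show ?thesis
      using f_mem by blast
  qed
  moreover have "f (perm_act pt x p) = tensor_act L S (f x) p" for x p
  proof -
    have act: "\<psi> (frag_extend (\<lambda>(l, b). frag_of (l, b * p)) z) = perm_act pt (\<psi> z) p" for z
      using subset_UNIV
    proof (induction z rule: frag_induction)
      case (one u)
      then show ?case
        by (cases u) (simp add: \<psi>_of act_mult)
    qed (simp_all add: \<psi>_0 \<psi>_diff frag_extend_diff act_diff_left)
    have "tensor_act L S (f x) p = (\<Union>z\<in>f x. f (perm_act pt x p))"
      unfolding tensor_act_def cls act by (intro SUP_cong refl) (simp add: f_def)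
    then show ?thesis
      using f_mem by blast
  qed
  ultimately have "iso_tensor (perm_act pt) L S"
    unfolding iso_tensor_def by blast
  then show ?thesis
    unfolding monomial_module_def using K by (auto simp: L_def S_def)
qed

end

section \<open>Growth\<close>

definition letter_val :: "'g::group_add \<times> bool \<Rightarrow> 'g" where
  "letter_val l = (if snd l then fst l else - fst l)"

lemma letter_val_inv_letter [simp]: "letter_val (inv_letter l) = - letter_val l"
  by (simp add: letter_val_def inv_letter_def)

lemma word_val_simps [simp]:
  "word_val [] = 0" "word_val (l # w) = letter_val l + word_val w"
  by (simp_all add: word_val_def letter_val_def case_prod_unfold)

lemma word_val_append [simp]: "word_val (v @ w) = word_val v + word_val w"
  by (induction v) (simp_all add: add.assoc)

lemma word_val_power: "word_val (concat (replicate m w)) = sum_list (replicate m (word_val w))"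
  by (induction m) simp_all

lemma word_val_inv_word [simp]: "word_val (inv_word w) = - word_val w"
  by (induction w) (simp_all add: minus_add)

text \<open>Cancelling a letter against its inverse changes neither the value nor, by
  \<open>step_inv_letter\<close>, any run. Hence runs depend only on the group element, and the free
  group acts on the vertices.\<close>

lemma reduce_word:
  fixes X :: "'g::group_add set"
  assumes "gluing X \<mu>" and "set w \<subseteq> X \<times> UNIV"
  shows "\<exists>w'\<in>reduced_words X. word_val w' = word_val w \<and> length w' \<le> length w \<and>
    (\<forall>v\<in>verts X \<mu>. run \<mu> v w' = run \<mu> v w)"
  using assms(2)
proof (induction w)
  case Nil
  then show ?case
    by (auto simp: reduced_words_eq)
next
  case (Cons l w)
  interpret gluing X \<mu> by fact
  obtain w' where w': "w' \<in> reduced_words X" "word_val w' = word_val w" "length w' \<le> length w"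
      "\<And>v. v \<in> verts X \<mu> \<Longrightarrow> run \<mu> v w' = run \<mu> v w"
    using Cons by auto
  have l: "l \<in> X \<times> UNIV"
    using Cons.prems by simp
  have run: "run \<mu> v (l # w) = run \<mu> (step \<mu> v l) w'" if "v \<in> verts X \<mu>" for v
    using w'(4)[OF step_verts[OF that l]] by simp
  show ?case
  proof (cases "\<exists>u. w' = inv_letter l # u")
    case True
    then obtain u where u: "w' = inv_letter l # u"
      by blast
    have "word_val u = word_val (l # w)"
      using w'(2)[symmetric] u by (simp flip: add.assoc)
    moreover have "run \<mu> v u = run \<mu> v (l # w)" if "v \<in> verts X \<mu>" for v
      using run[OF that] step_inv_letter[OF that] by (simp add: u)
    moreover have "u \<in> reduced_words X"
      using w'(1) by (auto simp: u reduced_words_eq successively_Cons)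
    ultimately show ?thesis
      using w'(3) by (intro bexI[of _ u]) (simp_all add: u)
  next
    case False
    then have "l # w' \<in> reduced_words X"
      using w'(1) l by (cases w') (auto simp: reduced_words_eq)
    then show ?thesis
      using w' run by (intro bexI[of _ "l # w'"]) simp_all
  qed
qed

text \<open>The Cayley tree itself, for uses of \<open>reduce_word\<close> in which only values and
  lengths matter.\<close>

lemma gluing_None: "gluing X (\<lambda>_. None)"
  by standard auto

definition word_of :: "'g::group_add set \<Rightarrow> 'g \<Rightarrow> 'g word" where
  "word_of X g = the_inv_into (reduced_words X) word_val g"

context
  fixes X :: "'g::group_add set"
  assumes free: "free_basis X"
begin

lemma word_of: "word_of X g \<in> reduced_words X" "word_val (word_of X g) = g"
  using free unfolding free_basis_def bij_betw_def word_of_def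
  by (simp_all add: the_inv_into_into f_the_inv_into_f)

lemma word_of_word_val: "w \<in> reduced_words X \<Longrightarrow> word_of X (word_val w) = w"
  using free unfolding free_basis_def bij_betw_def word_of_def by (simp add: the_inv_into_f_f)

lemma set_word_of: "set (word_of X g) \<subseteq> X \<times> UNIV"
  using word_of(1) by (auto simp: reduced_words_eq)

lemma reduced_length_eq: "reduced_length X g = length (word_of X g)"
  by (simp add: reduced_length_def word_of_def)

lemma reduced_length_word_val:
  assumes "set w \<subseteq> X \<times> UNIV" shows "reduced_length X (word_val w) \<le> length w"
proof -
  from reduce_word[OF gluing_None assms] obtain w' where "w' \<in> reduced_words X"
      "word_val w' = word_val w" "length w' \<le> length w"
    by blast
  then show ?thesis
    using word_of_word_val[of w'] by (simp add: reduced_length_eq)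
qed

lemma ball_eq: "{g. reduced_length X g \<le> n} = word_val ` {w \<in> reduced_words X. length w \<le> n}"
proof
  show "{g. reduced_length X g \<le> n} \<subseteq> word_val ` {w \<in> reduced_words X. length w \<le> n}"
  proof
    fix g assume "g \<in> {g. reduced_length X g \<le> n}"
    then show "g \<in> word_val ` {w \<in> reduced_words X. length w \<le> n}"
      using word_of[of g] by (intro image_eqI[of _ _ "word_of X g"]) (simp_all add: reduced_length_eq)
  qed
  show "word_val ` {w \<in> reduced_words X. length w \<le> n} \<subseteq> {g. reduced_length X g \<le> n}"
    by (auto simp: reduced_length_eq word_of_word_val)
qed

lemma card_ball: "card {g. reduced_length X g \<le> n} = card {w \<in> reduced_words X. length w \<le> n}"
proof -
  have "inj_on word_val {w \<in> reduced_words X. length w \<le> n}"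
    using free by (auto simp: free_basis_def bij_betw_def intro: inj_on_subset)
  then show ?thesis
    unfolding ball_eq by (rule card_image)
qed

lemma finite_ball:
  assumes "finite X" shows "finite {g. reduced_length X g \<le> n}"
proof -
  have "{w \<in> reduced_words X. length w \<le> n} = (\<Union>i\<le>n. {w \<in> reduced_words X. length w = i})"
    by auto
  then show ?thesis
    unfolding ball_eq using finite_reduced_words_length[OF assms] by simp
qed

lemma run_word_of_add:
  assumes "gluing X \<mu>" "v \<in> verts X \<mu>"
  shows "run \<mu> v (word_of X (g + h)) = run \<mu> (run \<mu> v (word_of X g)) (word_of X h)"
proof -
  have "set (word_of X g @ word_of X h) \<subseteq> X \<times> UNIV"
    using set_word_of by auto
  from reduce_word[OF assms(1) this] obtain w where "w \<in> reduced_words X"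
      "word_val w = g + h" "run \<mu> v w = run \<mu> v (word_of X g @ word_of X h)"
    using assms(2) word_of(2) by auto
  then show ?thesis
    using word_of_word_val[of w] by simp
qed

lemma run_word_of_word_val:
  assumes "gluing X \<mu>" "v \<in> verts X \<mu>" "set w \<subseteq> X \<times> UNIV"
  shows "run \<mu> v (word_of X (word_val w)) = run \<mu> v w"
proof -
  from reduce_word[OF assms(1,3)] obtain w' where "w' \<in> reduced_words X"
      "word_val w' = word_val w" "run \<mu> v w' = run \<mu> v w"
    using assms(2) by auto
  then show ?thesis
    using word_of_word_val[of w'] by simp
qed

end

text \<open>Matching outer letters are stripped off. Something always remains, since a letter
  followed by its inverse is not reduced.\<close>

lemma cyclic_reduction:
  assumes "reduced w" "w \<noteq> []"
  shows "\<exists>u c. cyclically_reduced c \<and> w = u @ c @ inv_word u"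
  using assms
proof (induction w rule: length_induct)
  case (1 w)
  show ?case
  proof (cases "hd w = inv_letter (last w)")
    case False
    then show ?thesis
      using "1.prems" by (intro exI[of _ "[]"] exI[of _ w]) (simp add: cyclically_reduced_def)
  next
    case True
    obtain l v where v: "w = l # v"
      using "1.prems"(2) by (cases w) auto
    have l: "l = inv_letter (last (l # v))"
      using True unfolding v by simp
    then have "v \<noteq> []"
      by auto
    then obtain v' k where v': "v = v' @ [k]"
      by (metis append_butlast_last_id)
    then have "k = inv_letter l"
      using l by (metis inv_letter_inv_letter last_ConsR last_snoc \<open>v \<noteq> []\<close>)
    then have w: "w = l # v' @ [inv_letter l]"
      using v v' by simp
    then have "v' \<noteq> []" "reduced v'"
      using "1.prems"(1) by (auto simp: successively_Cons successively_append_iff)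
    then obtain u c where "cyclically_reduced c" "v' = u @ c @ inv_word u"
      using "1.IH"[rule_format, of v'] by (auto simp: w)
    then show ?thesis
      using w by (intro exI[of _ "l # u"] exI[of _ c]) simp
  qed
qed

section \<open>Growth functions as dimensions\<close>

lemma growth_eq_dim:
  fixes act :: "'m::ab_group_add \<Rightarrow> ('g::group_add \<Rightarrow>\<^sub>0 'k::field) \<Rightarrow> 'm"
  assumes "right_module act"
  shows "growth X act A n =
    vector_space.dim (scalar act) {act a (grp_elt g) | a g. a \<in> A \<and> reduced_length X g \<le> n}"
proof -
  interpret right_module act by fact
  interpret V: vector_space "scalar act"
    by (rule vector_space_scalar[OF assms])
  interpret R: vector_space "scalar ((*) :: ('g \<Rightarrow>\<^sub>0 'k) \<Rightarrow> _)"
    by (rule vector_space_scalar[OF right_module_mult])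
  let ?S = "{act a p | a p. a \<in> A \<and> p \<in> ball_span X n}"
  let ?T = "{act a (grp_elt g) | a g. a \<in> A \<and> reduced_length X g \<le> n}"
  have "(grp_elt g :: 'g \<Rightarrow>\<^sub>0 'k) \<in> ball_span X n" if "reduced_length X g \<le> n" for g
    unfolding ball_span_def using that by (intro R.span_base imageI CollectI)
  then have "?T \<subseteq> ?S"
    by blast
  \<comment> \<open>Linearity in \<open>p\<close> reduces the span of the ball to the group elements
    in it.\<close>
  moreover have "act a p \<in> V.span ?T" if "a \<in> A" "p \<in> ball_span X n" for a p
    using that(2) unfolding ball_span_def
  proof (induction p rule: R.span_induct_alt)
    case base
    show ?case
      by (simp add: V.span_zero)
  next
    case (step c p q)
    then obtain g where "p = grp_elt g" "reduced_length X g \<le> n"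
      by auto
    then have "scalar act c (act a p) \<in> V.span ?T"
      using \<open>a \<in> A\<close> by (intro V.span_scale V.span_base) auto
    moreover have "act a (scalar (*) c p) = scalar act c (act a p)"
      by (simp add: scalar_def act_mult)
    ultimately show ?case
      using step.IH by (simp add: act_add_right V.span_add)
  qed
  then have "?S \<subseteq> V.span ?T"
    by auto
  ultimately have "V.span ?S = V.span ?T"
    unfolding V.span_eq using V.span_superset[of ?S] by blast
  then have "V.dim (V.span ?S) = V.dim (V.span ?T)"
    by (rule arg_cong)
  then show ?thesis
    unfolding growth_def V.dim_span .
qed

text \<open>The coordinates at \<open>J\<close> are dual to the vectors \<open>b i\<close>, so
  evaluating a linear relation at \<open>j\<close> isolates one coefficient. The general
  \<open>s\<close> covers both the group algebra and permutation modules.\<close>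

lemma independent_dual:
  fixes s :: "'k::field \<Rightarrow> ('p \<Rightarrow>\<^sub>0 'k) \<Rightarrow> ('p \<Rightarrow>\<^sub>0 'k)" and b :: "'p \<Rightarrow> ('p \<Rightarrow>\<^sub>0 'k)"
  assumes "vector_space s"
    and s: "\<And>c x i. Poly_Mapping.lookup (s c x) i = c * Poly_Mapping.lookup x i"
    and b: "\<And>i j. i \<in> J \<Longrightarrow> j \<in> J \<Longrightarrow> Poly_Mapping.lookup (b i) j = (if i = j then 1 else 0)"
  shows "inj_on b J" "\<not> module.dependent s (b ` J)"
proof -
  interpret vector_space s by fact
  show inj: "inj_on b J"
    using b by (intro inj_onI) (metis zero_neq_one)
  show "\<not> dependent (b ` J)"
    unfolding independent_explicit_module
  proof (intro allI impI)
    fix T u v assume T: "finite T" "T \<subseteq> b ` J" "(\<Sum>v\<in>T. s (u v) v) = 0" "v \<in> T"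
    then obtain j where j: "j \<in> J" "v = b j"
      by blast
    have "Poly_Mapping.lookup w j = (if w = v then 1 else 0)" if w: "w \<in> T" for w
    proof -
      obtain i where "i \<in> J" "w = b i"
        using T(2) w by blast
      then show ?thesis
        using b[of i j] j inj by (auto dest: inj_onD)
    qed
    then have "(\<Sum>w\<in>T. u w * (if w = v then 1 else 0)) = Poly_Mapping.lookup (\<Sum>w\<in>T. s (u w) w) j"
      unfolding lookup_sum s by (intro sum.cong) auto
    then show "u v = 0"
      using T by (simp add: if_distrib cong: if_cong)
  qed
qed

lemma (in vector_space) card_le_dim:
  assumes "finite S" "independent B" "B \<subseteq> span S" shows "card B \<le> dim S"
proof -
  obtain T where T: "T \<subseteq> S" "independent T" "S \<subseteq> span T"
    using maximal_independent_subset by blast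
  then have "card T = dim S"
    by (intro basis_card_eq_dim)
  moreover have "B \<subseteq> span T"
    using assms(3) span_minimal[OF T(3) subspace_span] by blast
  ultimately show ?thesis
    using independent_span_bound[OF finite_subset[OF T(1) assms(1)] assms(2)] by simp
qed

lemma lookup_scalar_mult:
  "Poly_Mapping.lookup (scalar (*) c x) g = (c :: 'k::field) * Poly_Mapping.lookup x (g :: 'g::group_add)"
proof (induction x rule: poly_mapping_induct_add)
  case (single j d)
  show ?case
    by (simp add: scalar_def mult_single lookup_single when_def mult.commute)
qed (simp add: scalar_def distrib_right lookup_add distrib_left)

lemma growth_free:
  "growth X ((*) :: ('g::group_add \<Rightarrow>\<^sub>0 'k::field) \<Rightarrow> _) {1} n = card {g. reduced_length X g \<le> n}"
proof -
  interpret R: vector_space "scalar ((*) :: ('g \<Rightarrow>\<^sub>0 'k) \<Rightarrow> _)"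
    by (rule vector_space_scalar[OF right_module_mult])
  let ?b = "grp_elt :: 'g \<Rightarrow> ('g \<Rightarrow>\<^sub>0 'k)"
  have "{a * ?b g | a g. a \<in> {1} \<and> reduced_length X g \<le> n} = ?b ` {g. reduced_length X g \<le> n}"
    by auto
  moreover note independent_dual[OF R.vector_space_axioms lookup_scalar_mult, of "{g. reduced_length X g \<le> n}" ?b]
  ultimately show ?thesis
    by (simp add: growth_eq_dim[OF right_module_mult] R.dim_eq_card_independent card_image
        lookup_single when_def)
qed

context perm_module
begin

text \<open>Acting with the ball of radius \<open>n\<close> on the differences of \<open>x0\<close>
  and its neighbours yields a space between the span of all \<open>j - x0\<close> and the span of
  all \<open>j\<close>, for \<open>j\<close> in the ball \<open>J (Suc n)\<close> around
  \<open>x0\<close>. The hypothesis \<open>large\<close> compares this ball with a ball of the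
  group.\<close>

lemma maximal_growth_aug:
  fixes x0 :: 'p
  assumes free: "free_basis X" "finite X"
    and transitive: "\<And>i. \<exists>g. pt x0 g = i"
    and simple: "simple_submodule (perm_act pt :: ('p \<Rightarrow>\<^sub>0 'k::field) \<Rightarrow> _) {x. aug x = 0}"
    and large: "\<And>n. card {g. reduced_length X g \<le> n} < card (pt x0 ` {g. reduced_length X g \<le> Suc n})"
    and N: "{x. aug x = 0} \<subseteq> N"
  shows "maximal_growth X (perm_act pt :: ('p \<Rightarrow>\<^sub>0 'k) \<Rightarrow> _) N"
proof -
  let ?act = "perm_act pt :: ('p \<Rightarrow>\<^sub>0 'k) \<Rightarrow> ('g \<Rightarrow>\<^sub>0 'k) \<Rightarrow> _"
  let ?D = "\<lambda>j. grp_elt j - grp_elt x0 :: 'p \<Rightarrow>\<^sub>0 'k"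
  interpret V: vector_space "scalar ?act"
    by (rule vector_space_scalar[OF right_module_axioms])
  define A where "A = (\<lambda>l. ?D (pt x0 (letter_val l))) ` (X \<times> UNIV)"
  have "finite A"
    using free(2) by (simp add: A_def)
  have A_aug: "A \<subseteq> {x. aug x = 0}"
    by (auto simp: A_def)
  define J where "J n = pt x0 ` {g. reduced_length X g \<le> n}" for n
  have finJ: "finite (J n)" for n
    using finite_ball[OF free] by (simp add: J_def)
  define S where "S n = {?act a (grp_elt g) | a g. a \<in> A \<and> reduced_length X g \<le> n}" for n
  have "S n = (\<lambda>(a, g). ?act a (grp_elt g)) ` (A \<times> {g. reduced_length X g \<le> n})" for n
    by (auto simp: S_def)
  then have finS: "finite (S n)" for n
    using \<open>finite A\<close> finite_ball[OF free] by simp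
  have growth: "growth X ?act A n = V.dim (S n)" for n
    unfolding S_def by (rule growth_eq_dim[OF right_module_axioms])
  have D_act: "?act (?D (pt x0 (letter_val l))) (grp_elt g) = ?D (pt x0 (letter_val l + g)) - ?D (pt x0 g)" for l g
    by (simp add: act_diff_left pt_add)

  have "V.dim (S n) \<le> card (J (Suc n))" for n
  proof -
    have "s \<in> V.span (grp_elt ` J (Suc n))" if s: "s \<in> S n" for s
    proof -
      obtain l g where lg: "l \<in> X \<times> UNIV" "reduced_length X g \<le> n"
          "s = ?act (?D (pt x0 (letter_val l))) (grp_elt g)"
        using s by (auto simp: S_def A_def)
      have "reduced_length X (word_val (l # word_of X g)) \<le> length (l # word_of X g)"
        using lg(1) set_word_of[OF free(1)] by (intro reduced_length_word_val[OF free(1)]) auto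
      then have "reduced_length X (letter_val l + g) \<le> Suc n"
        using lg(2) by (simp add: word_of[OF free(1)] reduced_length_eq[OF free(1)])
      then have "grp_elt (pt x0 (letter_val l + g)) \<in> V.span (grp_elt ` J (Suc n))"
          "grp_elt (pt x0 g) \<in> V.span (grp_elt ` J (Suc n))"
        using lg(2) by (auto simp: J_def intro!: V.span_base)
      then have "grp_elt (pt x0 (letter_val l + g)) - grp_elt (pt x0 g) \<in> V.span (grp_elt ` J (Suc n))"
        by (rule V.span_diff)
      then show ?thesis
        by (simp add: lg(3) D_act)
    qed
    then have "V.dim (S n) \<le> card (grp_elt ` J (Suc n) :: ('p \<Rightarrow>\<^sub>0 'k) set)"
      using finJ by (intro V.dim_le_card) auto
    also have "\<dots> \<le> card (J (Suc n))"
      by (rule card_image_le[OF finJ])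
    finally show ?thesis .
  qed
  moreover have "card (J (Suc n)) \<le> card {g. reduced_length X g \<le> Suc n}" for n
    unfolding J_def by (rule card_image_le[OF finite_ball[OF free]])
  ultimately have upper: "V.dim (S n) \<le> card {g. reduced_length X g \<le> Suc n}" for n
    using order.trans by blast

  \<comment> \<open>The letters of a word are removed from the front; each removal changes the
    endpoint by a vector of \<open>S n\<close>, because the remaining word has length at most
    \<open>n\<close>.\<close>
  have telescope: "?D (pt x0 (word_val w)) \<in> V.span (S n)"
    if "w \<in> reduced_words X" "length w \<le> Suc n" for w n
    using that
  proof (induction w)
    case Nil
    then show ?case
      by (simp add: V.span_zero)
  next
    case (Cons l w)
    have w: "w \<in> reduced_words X" "l \<in> X \<times> UNIV"
      using Cons.prems(1) by (auto simp: reduced_words_eq successively_Cons)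
    then have "reduced_length X (word_val w) \<le> n"
      using Cons.prems(2) by (simp add: reduced_length_eq[OF free(1)] word_of_word_val[OF free(1)])
    then have "?act (?D (pt x0 (letter_val l))) (grp_elt (word_val w)) \<in> S n"
      using w(2) unfolding S_def A_def by blast
    then have "?D (pt x0 (letter_val l + word_val w)) - ?D (pt x0 (word_val w)) \<in> V.span (S n)"
      unfolding D_act by (rule V.span_base)
    then have "(?D (pt x0 (letter_val l + word_val w)) - ?D (pt x0 (word_val w))) + ?D (pt x0 (word_val w)) \<in> V.span (S n)"
      using Cons w(1) by (intro V.span_add) auto
    then show ?case
      by simp
  qed
  have lower: "card {g. reduced_length X g \<le> n} \<le> V.dim (S n)" for n
  proof -
    \<comment> \<open>The difference belonging to \<open>x0\<close> is zero. The one dimension lost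
      is made up for by the strict inequality in \<open>large\<close>.\<close>
    let ?J = "J (Suc n) - {x0}"
    have "?D ` ?J \<subseteq> V.span (S n)"
      using telescope by (auto simp: J_def ball_eq[OF free(1)])
    moreover have dual: "Poly_Mapping.lookup (?D i) j = (if i = j then 1 else 0)" if "i \<in> ?J" "j \<in> ?J" for i j
      using that by (auto simp: lookup_minus lookup_single when_def)
    from independent_dual[where J = ?J and b = ?D, OF V.vector_space_axioms lookup_scalar dual]
    have "inj_on ?D ?J" "V.independent (?D ` ?J)"
      by blast+
    ultimately have "card ?J \<le> V.dim (S n)"
      using V.card_le_dim[OF finS] by (metis card_image)
    moreover have "card (J (Suc n)) \<le> Suc (card ?J)"
      using finJ by (simp add: card_Diff_singleton_if) linarith
    ultimately show ?thesis
      using large[of n] by (simp add: J_def)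
  qed

  have "growth_equiv (growth X ?act A) (growth X ((*) :: ('g \<Rightarrow>\<^sub>0 'k) \<Rightarrow> _) {1})"
    unfolding growth_equiv_def growth growth_free
    using upper lower by (intro exI[of _ 1] exI[of _ 0]) simp
  moreover have "{x. aug x = 0} = submodule ?act hull A"
  proof
    show "submodule ?act hull A \<subseteq> {x. aug x = 0}"
      by (intro hull_minimal submodule_aug A_aug)
    \<comment> \<open>By simplicity it is enough that \<open>W\<close> meets the kernel in a nonzero
      submodule, that is, that \<open>A\<close> has a nonzero element.\<close>
    have "W \<inter> {x. aug x = 0} = {x. aug x = 0}" if W: "submodule ?act W" "A \<subseteq> W" for W
    proof -
      have "submodule ?act (W \<inter> {x. aug x = 0})"
        using W(1) submodule_aug unfolding submodule_def by blast
      moreover have "\<not> A \<subseteq> {0}"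
      proof
        assume "A \<subseteq> {0}"
        \<comment> \<open>Otherwise the growth would vanish, against the lower bound for
          \<open>n = 0\<close>, as the ball of radius 0 contains the identity.\<close>
        then have "S n \<subseteq> {0}" for n
          by (auto simp: S_def)
        then have "V.dim (S 0) \<le> 0"
          using V.dim_le_card[of "S 0" "{}"] by simp
        moreover have "card {g. reduced_length X g \<le> 0} > 0"
          using finite_ball[OF free, of 0] word_of_word_val[OF free(1), of "[]"]
          by (auto simp: card_gt_0_iff reduced_length_eq[OF free(1)] reduced_words_eq)
        ultimately show False
          using lower[of 0] by simp
      qed
      then have "W \<inter> {x. aug x = 0} \<noteq> {0}"
        using W(2) A_aug by blast
      ultimately show ?thesis
        using simple unfolding simple_submodule_def by blast
    qed
    then show "{x. aug x = 0} \<subseteq> submodule ?act hull A"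
      unfolding hull_def by blast
  qed
  ultimately have "maximal_growth_fg X ?act {x. aug x = 0}"
    unfolding maximal_growth_fg_def using \<open>finite A\<close> by blast
  then show ?thesis
    unfolding maximal_growth_def using N submodule_aug by blast
qed

end

section \<open>The periodic module\<close>

lemma sum_list_replicate_conj:
  "sum_list (replicate m (a + b - a)) = a + sum_list (replicate m b) - (a :: 'a::group_add)"
  by (induction m) (simp_all add: diff_conv_add_uminus add.assoc del: add_uminus_conv_diff)

theorem corollary9:
  fixes X :: "'g::group_add set" and r :: nat
  assumes "free_basis X" and "finite X" and "card X = r" and "r > 1"
  shows "\<exists>act :: (nat \<Rightarrow>\<^sub>0 'k::field) \<Rightarrow> ('g \<Rightarrow>\<^sub>0 'k) \<Rightarrow> (nat \<Rightarrow>\<^sub>0 'k).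
    right_module act \<and>
    maximal_growth X act UNIV \<and>
    monomial_module act \<and>
    (\<exists>N. simple_submodule act N \<and> has_codim act N 1 \<and> maximal_growth X act N \<and>
         periodic act UNIV \<and> periodic act N)"
proof -
  have card_X: "card X \<ge> 2"
    using assms(3,4) by simp
  note free = assms(1) and fin = assms(2)
  from periodic_highly_transitive_gluing[OF fin card_X] obtain \<mu> where gl: "gluing X \<mu>"
    and periodic: "\<forall>v\<in>verts X \<mu>. \<forall>c. cyclically_reduced c \<longrightarrow> set c \<subseteq> X \<times> UNIV \<longrightarrow>
        (\<exists>m>0. run \<mu> v (concat (replicate m c)) = v)"
    and swap: "\<forall>Z x y. finite Z \<longrightarrow> Z \<subseteq> verts X \<mu> \<longrightarrow> x \<in> Z \<longrightarrow> y \<in> Z \<longrightarrow>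
        (\<exists>u. set u \<subseteq> X \<times> UNIV \<and> (\<forall>z\<in>Z. run \<mu> z u = (if z = x then y else if z = y then x else z)))"
    by (elim exE conjE)
  interpret gluing X \<mu> by (rule gl)
  define V where "V = verts X \<mu>"
  define q where "q = 2 * card X - 1"
  have count: "q ^ Suc n + Suc n \<le> card {v \<in> V. length v = Suc n}" for n
    unfolding q_def V_def by (rule card_verts_length_ge[OF fin card_X])
  have "countable V"
  proof (rule countable_subset)
    show "V \<subseteq> lists (X \<times> UNIV)"
      by (auto simp: V_def verts_def reduced_words_eq)
    show "countable (lists (X \<times> (UNIV :: bool set)))"
      using fin by (simp add: countable_finite)
  qed
  have "infinite V"
  proof
    assume "finite V"
    define n where "n = card V"
    have "card {v \<in> V. length v = Suc n} \<le> n"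
      unfolding n_def using \<open>finite V\<close> by (intro card_mono) auto
    then show False
      using count[of n] by linarith
  qed
  \<comment> \<open>The vertices are numbered by all natural numbers and the action is transported,
    since the module lives on finitely supported functions on \<open>nat\<close>.\<close>
  define e where "e = to_nat_on V"
  define d where "d = from_nat_into V"
  have V: "d i \<in> V" "e (d i) = i" "v \<in> V \<Longrightarrow> d (e v) = v" for i v
    using \<open>countable V\<close> \<open>infinite V\<close> from_nat_into[of V i]
    by (auto simp: e_def d_def to_nat_on_from_nat_into_infinite)
  have d_inj: "d i = d j \<longleftrightarrow> i = j" for i j
    by (metis V(2))
  have Nil: "[] \<in> V"
    using Nil_verts by (simp add: V_def)

  define pt where "pt i g = e (run \<mu> (d i) (word_of X g))" for i g
  have run_V: "run \<mu> (d i) w \<in> V" if "set w \<subseteq> X \<times> UNIV" for i w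
    using run_verts[OF _ that] V(1) by (simp add: V_def)
  have pt_word: "pt i (word_val w) = e (run \<mu> (d i) w)" if "set w \<subseteq> X \<times> UNIV" for i w
    using run_word_of_word_val[OF free gl _ that] V(1) by (simp add: pt_def V_def)
  interpret perm_module pt
  proof
    show "pt i 0 = i" for i
      using pt_word[of "[]" i] V(2) by simp
    show "pt i (g + h) = pt (pt i g) h" for i g h
      using run_word_of_add[OF free gl, of "d i" g h] V(1)[of i] run_V[OF set_word_of[OF free], of i g] V(3)
      by (simp add: pt_def V_def)
  qed
  define x0 where "x0 = e []"
  \<comment> \<open>A vertex is a word that leads from the root to itself.\<close>
  have pt_x0: "pt x0 (word_val v) = e v" if "v \<in> V" for v
  proof -
    have "set v \<subseteq> X \<times> UNIV"
      using that by (auto simp: V_def verts_def reduced_words_eq)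
    moreover have "run \<mu> [] v = v"
      using run_push[of "[]" v X \<mu>] that by (simp add: V_def)
    ultimately show ?thesis
      using pt_word[of v x0] V(3)[OF Nil] by (simp add: x0_def)
  qed
  have transitive: "\<exists>g. pt x0 g = i" for i
    using pt_x0[OF V(1)[of i]] V(2) by auto
  have simple: "simple_submodule (perm_act pt :: (nat \<Rightarrow>\<^sub>0 'k) \<Rightarrow> ('g \<Rightarrow>\<^sub>0 'k) \<Rightarrow> _) {x. aug x = 0}"
  proof (rule simple_aug)
    fix Z and x y :: nat assume Z: "finite Z" "x \<in> Z" "y \<in> Z"
    have "finite (d ` Z)" "d ` Z \<subseteq> verts X \<mu>" "d x \<in> d ` Z" "d y \<in> d ` Z"
      using Z V(1) by (auto simp: V_def)
    from swap[rule_format, OF this] obtain u where u: "set u \<subseteq> X \<times> UNIV"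
        "\<forall>z\<in>d ` Z. run \<mu> z u = (if z = d x then d y else if z = d y then d x else z)"
      by blast
    then have "\<forall>z\<in>Z. pt z (word_val u) = (if z = x then y else if z = y then x else z)"
      by (simp add: pt_word d_inj V(2))
    then show "\<exists>g. \<forall>z\<in>Z. pt z g = (if z = x then y else if z = y then x else z)" ..
  qed simp
  have "\<exists>m>0. pt i (sum_list (replicate m g)) = i" for i g
  proof (cases "word_of X g = []")
    case True
    then have "g = 0"
      using word_of(2)[OF free, of g] by simp
    then show ?thesis
      by (intro exI[of _ 1]) simp
  next
    case False
    have w: "set (word_of X g) \<subseteq> X \<times> UNIV" "reduced (word_of X g)"
      using word_of(1)[OF free, of g] by (auto simp: reduced_words_eq)
    \<comment> \<open>The limit action handles cyclically reduced words only. Here \<open>g\<close>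
      is a conjugate of such a \<open>c\<close>, and a period of \<open>c\<close> at the point
      reached by \<open>u\<close> is a period of \<open>g\<close> at the given point.\<close>
    from cyclic_reduction[OF w(2) False] obtain u c where
      uc: "cyclically_reduced c" "word_of X g = u @ c @ inv_word u"
      by blast
    then have set: "set u \<subseteq> X \<times> UNIV" "set c \<subseteq> X \<times> UNIV"
      using w(1) by simp_all
    obtain m where m: "m > 0" "run \<mu> (run \<mu> (d i) u) (concat (replicate m c)) = run \<mu> (d i) u"
      using periodic[rule_format, OF _ uc(1) set(2)] run_V[OF set(1)] by (auto simp: V_def)
    have "g = word_val u + word_val c - word_val u"
      using word_of(2)[OF free, of g] unfolding uc(2)
      by (simp add: diff_conv_add_uminus add.assoc del: add_uminus_conv_diff)
    then have "sum_list (replicate m g) = word_val (u @ concat (replicate m c) @ inv_word u)"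
      using sum_list_replicate_conj[of m "word_val u" "word_val c"]
      by (simp add: word_val_power diff_conv_add_uminus add.assoc del: add_uminus_conv_diff)
    moreover have "set (u @ concat (replicate m c) @ inv_word u) \<subseteq> X \<times> UNIV"
      using set inv_word_mem[of u X] by (auto split: if_splits simp del: inv_word_mem)
    moreover have "run \<mu> (d i) (u @ concat (replicate m c) @ inv_word u) = d i"
      using run_inv_word[OF _ set(1), of "d i"] V(1) m(2) by (simp add: V_def)
    ultimately show ?thesis
      using m(1) pt_word[of "u @ concat (replicate m c) @ inv_word u" i] V(2) by (intro exI[of _ m]) simp
  qed
  then have periodic: "periodic (perm_act pt :: (nat \<Rightarrow>\<^sub>0 'k) \<Rightarrow> _) N" for N
    by (rule periodic_perm_act)
  \<comment> \<open>Already the vertices of the single level \<open>Suc n\<close> outnumber the ball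
    of radius \<open>n\<close>, because \<open>2 \<le> q\<close>; the surplus in
    \<open>count\<close> makes the inequality strict.\<close>
  have large: "card {g. reduced_length X g \<le> n} < card (pt x0 ` {g. reduced_length X g \<le> Suc n})" for n
  proof -
    have "card {g. reduced_length X g \<le> n} \<le> 2 * q ^ n"
      unfolding card_ball[OF free] q_def by (rule card_ball_le[OF fin card_X])
    also have "\<dots> \<le> q * q ^ n"
      using card_X by (intro mult_right_mono) (simp_all add: q_def)
    also have "\<dots> < card {v \<in> V. length v = Suc n}"
      using count[of n] by simp
    also have "\<dots> = card (e ` {v \<in> V. length v = Suc n})"
      using V(3) by (intro card_image[symmetric] inj_on_inverseI[of _ d]) auto
    also have "\<dots> \<le> card (pt x0 ` {g. reduced_length X g \<le> Suc n})"
    proof (intro card_mono finite_imageI finite_ball[OF free fin] image_subsetI)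
      fix v assume v: "v \<in> {v \<in> V. length v = Suc n}"
      then have "v \<in> reduced_words X"
        by (simp add: V_def verts_def)
      then have "reduced_length X (word_val v) \<le> Suc n"
        using v by (simp add: reduced_length_eq[OF free] word_of_word_val[OF free])
      then show "e v \<in> pt x0 ` {g. reduced_length X g \<le> Suc n}"
        using v pt_x0[of v] by (intro image_eqI[of _ _ "word_val v"]) simp_all
    qed
    finally show ?thesis .
  qed
  have growth: "maximal_growth X (perm_act pt :: (nat \<Rightarrow>\<^sub>0 'k) \<Rightarrow> _) N" if "{x. aug x = 0} \<subseteq> N" for N
    by (rule maximal_growth_aug[OF free fin transitive simple large that])
  show ?thesis
    using right_module_axioms growth[of UNIV] growth[of "{x. aug x = 0}"] monomial_perm_act[OF transitive]
      simple has_codim_aug periodic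
    by (intro exI[of _ "perm_act pt"] conjI exI[of _ "{x. aug x = 0}"]) simp_all
qed

end
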